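(* Let $n\ge 1$ and $\omega>0$. For $i=1,\dots,n$ let $a_i,b_i\in C(\mathbb{R},[0,\infty))$ be $\omega$-periodic with $\bar a_i>0$ and $\bar b_i>0$, let $\tau\in C(\mathbb{R},\mathbb{R})$ be $\omega$-periodic, and let $f^i:\mathbb{R}_+^n\to[0,\infty)$ be continuous with $f^i(\mathbf{x})>0$ whenever $\|\mathbf{x}\|>0$. Assume that the limits $f_0^i$ and $f_\infty^i$ exist in $[0,\infty]$ for each $i$. For $\lambda>0$ consider the system $$x_i'(t)=-a_i(t)x_i(t)+\lambda b_i(t) f^i(\mathbf{x}(t-\tau(t))),\qquad i=1,\dots,n. \quad ( * )$$ Then: (a) If $i_0=1$ or $2$, then $( * )$ has (at least) $i_0$ positive $\omega$-periodic solution(s) for every $\lambda>\frac{1}{m(1)\Gamma}>0$. (b) If $i_\infty=1$ or $2$, then $( * )$ has (at least) $i_\infty$ positive $\omega$-periodic solution(s) for every $0<\lambda<\frac{1}{M(1)\chi}$. (c) If $i_0=0$, then $( * )$ has no positive $\omega$-periodic solution for all sufficiently large $\lambda>0$; if $i_\infty=0$, then $( * )$ has no positive $\omega$-periodic solution for all sufficiently small $\lambda>0$. (d) If $i_0=i_\infty=1$, then $( * )$ has a positive $\omega$-periodic solution for all $\lambda>0$.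
   Context: Notation: $\mathbb{R}_+=[0,\infty)$, $\mathbb{R}_+^n$ is the nonnegative orthant, $\|\mathbf{x}\|=\sum_{i=1}^n|x_i|$ for $\mathbf{x}\in\mathbb{R}_+^n$, and $\bar g=\frac1\omega\int_0^\omega g(s)\,ds$ for an $\omega$-periodic function $g$. Constants: $\sigma_i=e^{-\bar a_i\omega}$, $\sigma=\min_{1\le i\le n}\sigma_i$, $$\Gamma=\min_{1\le i\le n}\frac{\bar b_i\omega}{\sigma_i^{-1}-1},\qquad \chi=\sum_{i=1}^n\frac{\sigma_i^{-1}}{\sigma_i^{-1}-1}\,\bar b_i\omega,$$ and for $r>0$, $$M(r)=\max\{f^i(\mathbf{x}): 1\le i\le n,\ \mathbf{x}\in\mathbb{R}_+^n,\ \|\mathbf{x}\|\le r\},$$ $$m(r)=\min\{f^i(\mathbf{x}): 1\le i\le n,\ \mathbf{x}\in\mathbb{R}_+^n,\ \sigma r\le\|\mathbf{x}\|\le r\}.$$ Limits: $f_0^i=\lim_{\|\mathbf{x}\|\to0}\frac{f^i(\mathbf{x})}{\|\mathbf{x}\|}$ and $f_\infty^i=\lim_{\|\mathbf{x}\|\to\infty}\frac{f^i(\mathbf{x})}{\|\mathbf{x}\|}$ (over $\mathbf{x}\in\mathbb{R}_+^n\setminus\{0\}$, values in $[0,\infty]$); $\mathbf{F}_0=\max_i f_0^i$, $\mathbf{F}_\infty=\max_i f_\infty^i$. $i_0\in\{0,1,2\}$ is the number of zeros among the two quantities $\mathbf{F}_0,\mathbf{F}_\infty$ (counted with multiplicity),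 and $i_\infty\in\{0,1,2\}$ is the number of infinities among the two quantities $\mathbf{F}_0,\mathbf{F}_\infty$ (counted with multiplicity). A solution $\mathbf{x}(t)=(x_1(t),\dots,x_n(t))$, $t\in\mathbb{R}$, is called positive if $x_i(t)\ge0$ for all $t\in\mathbb{R}$ and all $i$, and there is at least one component which is positive on all of $\mathbb{R}$. *)

theory Defs
  imports "HOL-Analysis.Analysis"
begin

definition orthant :: "(real ^ 'n::finite) set" where
  "orthant = {x. \<forall>i. 0 \<le> x $ i}"

definition l1norm :: "real ^ 'n::finite \<Rightarrow> real" where
  "l1norm x = (\<Sum>i\<in>UNIV. \<bar>x $ i\<bar>)"

definition periodic :: "real \<Rightarrow> (real \<Rightarrow> 'a) \<Rightarrow> bool" where
  "periodic \<omega> g \<longleftrightarrow> (\<forall>t. g (t + \<omega>) = g t)"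

definition mean :: "real \<Rightarrow> (real \<Rightarrow> real) \<Rightarrow> real" where
  "mean \<omega> g = 1 / \<omega> * integral {0..\<omega>} g"

text \<open>The filters for \<open>\<parallel>x\<parallel> \<rightarrow> 0\<close> and \<open>\<parallel>x\<parallel> \<rightarrow> \<infinity>\<close>, with \<open>x\<close> ranging over the nonzero
  points of the orthant; \<open>at_right 0\<close> excludes the origin.\<close>

definition orthant_at_0 :: "(real ^ 'n::finite) filter" where
  "orthant_at_0 = inf (filtercomap l1norm (at_right 0)) (principal orthant)"

definition orthant_at_infinity :: "(real ^ 'n::finite) filter" where
  "orthant_at_infinity = inf (filtercomap l1norm at_top) (principal orthant)"

definition sigma_comp :: "real \<Rightarrow> ('n::finite \<Rightarrow> real \<Rightarrow> real) \<Rightarrow> 'n \<Rightarrow> real" where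
  "sigma_comp \<omega> a i = exp (- (mean \<omega> (a i) * \<omega>))"

definition sigma :: "real \<Rightarrow> ('n::finite \<Rightarrow> real \<Rightarrow> real) \<Rightarrow> real" where
  "sigma \<omega> a = Min (range (sigma_comp \<omega> a))"

definition Gamma_const ::
  "real \<Rightarrow> ('n::finite \<Rightarrow> real \<Rightarrow> real) \<Rightarrow> ('n \<Rightarrow> real \<Rightarrow> real) \<Rightarrow> real" where
  "Gamma_const \<omega> a b =
     Min (range (\<lambda>i. mean \<omega> (b i) * \<omega> / (inverse (sigma_comp \<omega> a i) - 1)))"

definition chi_const ::
  "real \<Rightarrow> ('n::finite \<Rightarrow> real \<Rightarrow> real) \<Rightarrow> ('n \<Rightarrow> real \<Rightarrow> real) \<Rightarrow> real" where
  "chi_const \<omega> a b =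
     (\<Sum>i\<in>UNIV. inverse (sigma_comp \<omega> a i) / (inverse (sigma_comp \<omega> a i) - 1)
                * (mean \<omega> (b i) * \<omega>))"

text \<open>The maximum and minimum below range over infinite sets, so \<open>Max\<close> and \<open>Min\<close> do not apply;
  for continuous \<open>f\<close> and \<open>r > 0\<close> they are attained by compactness.\<close>

definition M_const :: "('n::finite \<Rightarrow> real ^ 'n \<Rightarrow> real) \<Rightarrow> real \<Rightarrow> real" where
  "M_const f r = (GREATEST y. y \<in> {f i x | i x. x \<in> orthant \<and> l1norm x \<le> r})"

definition m_const ::
  "real \<Rightarrow> ('n::finite \<Rightarrow> real \<Rightarrow> real) \<Rightarrow> ('n \<Rightarrow> real ^ 'n \<Rightarrow> real) \<Rightarrow> real \<Rightarrow> real" where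
  "m_const \<omega> a f r =
     (LEAST y. y \<in> {f i x | i x. x \<in> orthant \<and> sigma \<omega> a * r \<le> l1norm x \<and> l1norm x \<le> r})"

definition num_zeros :: "('n::finite \<Rightarrow> ennreal) \<Rightarrow> ('n \<Rightarrow> ennreal) \<Rightarrow> nat" where
  "num_zeros f0 finf = count_list [Max (range f0), Max (range finf)] 0"

definition num_infinities :: "('n::finite \<Rightarrow> ennreal) \<Rightarrow> ('n \<Rightarrow> ennreal) \<Rightarrow> nat" where
  "num_infinities f0 finf = count_list [Max (range f0), Max (range finf)] \<infinity>"

definition is_solution ::
  "('n::finite \<Rightarrow> real \<Rightarrow> real) \<Rightarrow> ('n \<Rightarrow> real \<Rightarrow> real) \<Rightarrow> (real \<Rightarrow> real) \<Rightarrow>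
   ('n \<Rightarrow> real ^ 'n \<Rightarrow> real) \<Rightarrow> real \<Rightarrow> (real \<Rightarrow> real ^ 'n) \<Rightarrow> bool" where
  "is_solution a b \<tau> f lam x \<longleftrightarrow>
     (\<forall>i t. ((\<lambda>s. x s $ i) has_real_derivative
              - a i t * x t $ i + lam * b i t * f i (x (t - \<tau> t))) (at t))"

definition positive :: "(real \<Rightarrow> real ^ 'n::finite) \<Rightarrow> bool" where
  "positive x \<longleftrightarrow> (\<forall>i t. 0 \<le> x t $ i) \<and> (\<exists>i. \<forall>t. 0 < x t $ i)"

text \<open>Each \<open>f i\<close> is a total function but only its values on the orthant matter here,
  since a positive \<open>x\<close> takes values in the orthant.\<close>

definition positive_periodic_solutions ::
  "real \<Rightarrow> ('n::finite \<Rightarrow> real \<Rightarrow> real) \<Rightarrow> ('n \<Rightarrow> real \<Rightarrow> real) \<Rightarrow> (real \<Rightarrow> real) \<Rightarrow>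
   ('n \<Rightarrow> real ^ 'n \<Rightarrow> real) \<Rightarrow> real \<Rightarrow> (real \<Rightarrow> real ^ 'n) set" where
  "positive_periodic_solutions \<omega> a b \<tau> f lam =
     {x. is_solution a b \<tau> f lam x \<and> positive x \<and> periodic \<omega> x}"

definition has_at_least :: "nat \<Rightarrow> 'a set \<Rightarrow> bool" where
  "has_at_least k S \<longleftrightarrow> (\<exists>X\<subseteq>S. finite X \<and> card X = k)"

end

theory Submission
  imports Defs "HOL-Complex_Analysis.Great_Picard"
begin

text \<open>
  Variation of constants turns the system into a fixed point equation. For a continuous
  \<open>\<omega>\<close>-periodic forcing \<open>h\<close> the equation \<open>y' = -a\<^sub>i y + h\<close> has exactly one \<open>\<omega>\<close>-periodic solution
  (\<open>response\<close>), because the homogeneous solutions shrink by the factor \<open>\<sigma>\<^sub>i < 1\<close> over one period.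
  Inserting \<open>h(s) = \<lambda> b\<^sub>i(s) f\<^sup>i(x(s - \<tau>(s)))\<close> defines an operator \<open>T\<close> whose nonzero fixed points
  are the positive periodic solutions. The kernel of \<open>response\<close> lies between two positive
  constants whose ratio is \<open>\<sigma>\<^sub>i\<close>, so \<open>T\<close> maps into the cone of functions with
  \<open>x\<^sub>i(t) \<ge> \<sigma>\<^sub>i x\<^sub>i(s)\<close>. Hence \<open>\<sigma> r \<le> \<parallel>x(t)\<parallel> \<le> r\<close> for every \<open>t\<close> as soon as \<open>sup \<parallel>x(t)\<parallel> = r\<close>, and
  bounds of \<open>f\<close> on that shell, or on the whole ball, control \<open>T x\<close>: if some \<open>f\<^sup>i \<ge> m\<close> on the shell and \<open>\<lambda> m \<Gamma> > r\<close>, then \<open>T\<close>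
  enlarges all \<open>x\<close> of size \<open>r\<close> (\<open>grows\<close>); if all \<open>f\<^sup>i \<le> M\<close> on the ball and \<open>\<lambda> M \<chi> < r\<close>, it reduces
  them (\<open>shrinks\<close>).

  Krasnoselskii's theorem on cones gives a fixed point of size strictly between \<open>r\<close> and \<open>R\<close> whenever
  \<open>T\<close> grows at one of the two radii and shrinks at the other (\<open>solution_between\<close>). Every claim of
  the theorem is then a statement about radii. A limit of \<open>f\<^sup>i(x)/\<parallel>x\<parallel>\<close> being \<open>0\<close> for all \<open>i\<close> makes \<open>T\<close>
  shrink at all radii near \<open>0\<close> or near \<open>\<infinity>\<close>; a limit \<open>\<infinity>\<close> for one \<open>i\<close> makes it grow there. The bounds on
  \<open>\<lambda>\<close> in (a) and (b) say that \<open>T\<close> grows, respectively shrinks, at radius \<open>1\<close>; so the solutions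
  caused by the behaviour at \<open>0\<close> have size below \<open>1\<close>, those caused by the behaviour at \<open>\<infinity>\<close> have size
  above \<open>1\<close>, and the two are distinct. In (c) the operator grows at every radius when \<open>\<lambda>\<close> is large, respectively
  shrinks at every radius when \<open>\<lambda>\<close> is small, which excludes nonzero fixed points; and in (d) it grows at one end and shrinks at the other.

  Krasnoselskii's theorem is derived from Schauder's: for compression the ball of the cone is
  retracted to the annulus, and expansion is reduced to compression by rescaling \<open>T x\<close> so that its
  size is inverted with respect to that of \<open>x\<close>. Schauder's theorem needs fixed
  points in simplices whose dimension depends on the required accuracy. They are obtained from the
  Hilbert cube, whose fixed point property follows from Kuhn's combinatorial lemma
  applied in \<open>p\<close> coordinates with mesh \<open>1/p\<close> for all \<open>p\<close> at once.
\<close>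

section \<open>The fixed point property of the Hilbert cube\<close>
lemma tendsto_coordinatewise:
  fixes X :: "'c \<Rightarrow> 'a \<Rightarrow> 'b::topological_space"
  shows "(X \<longlongrightarrow> l) F \<longleftrightarrow> (\<forall>i. ((\<lambda>n. X n i) \<longlongrightarrow> l i) F)"
  using limitin_componentwise[of "\<lambda>_. euclidean" UNIV X l F]
  by (simp add: euclidean_product_topology)

text \<open>
  A cube with one factor for each natural number contains the finite-dimensional cubes of all
  dimensions in a single type, so that the dimension may be chosen inside a proof.
\<close>
definition hilbert_cube :: "(nat \<Rightarrow> real) set" where
  "hilbert_cube = {c. \<forall>i. 0 \<le> c i \<and> c i \<le> 1}"

lemma compact_hilbert_cube: "compact hilbert_cube"
proof -
  have "hilbert_cube = PiE UNIV (\<lambda>_. {0..1})"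
    by (auto simp: hilbert_cube_def PiE_def Pi_def)
  moreover have "compactin (product_topology (\<lambda>_::nat. euclidean) UNIV) (PiE UNIV (\<lambda>_. {0..1::real}))"
    by (subst compactin_PiE) auto
  ultimately show ?thesis
    by (simp add: euclidean_product_topology)
qed

text \<open>
  Only the first \<open>p\<close> coordinates are discretised, with mesh \<open>1/p\<close>; the others are set to \<open>0\<close>. A
  grid point is labelled in direction \<open>i\<close> by the side to which \<open>g\<close> moves its \<open>i\<close>-th coordinate, and
  the grid cell supplied by Kuhn's lemma has vertices of both labels in every direction \<open>i < p\<close>.
\<close>
lemma kuhn_approximate_fixed_point:
  assumes g: "\<And>c. c \<in> hilbert_cube \<Longrightarrow> g c \<in> hilbert_cube" and "0 < p"
  shows "\<exists>w\<in>hilbert_cube. \<forall>i<p. \<exists>u\<in>hilbert_cube. \<exists>v\<in>hilbert_cube.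
           (\<forall>j. \<bar>u j - w j\<bar> \<le> 1 / real p) \<and> (\<forall>j. \<bar>v j - w j\<bar> \<le> 1 / real p) \<and>
           u i \<le> g u i \<and> g v i \<le> v i"
proof -
  define z :: "(nat \<Rightarrow> nat) \<Rightarrow> nat \<Rightarrow> real"
    where "z x = (\<lambda>j. if j < p then real (x j) / real p else 0)" for x
  have z: "z x \<in> hilbert_cube" if "\<forall>j<p. x j \<le> p" for x
    using that \<open>0 < p\<close> by (auto simp: z_def hilbert_cube_def)
  \<comment> \<open>On the face \<open>x i = p\<close> the label must be 1; this is consistent because \<open>g\<close> is at most 1.\<close>
  define label :: "(nat \<Rightarrow> nat) \<Rightarrow> nat \<Rightarrow> nat"
    where "label x i = (if x i < p \<and> z x i \<le> g (z x) i then 0 else 1)" for x i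
  obtain q where q: "\<forall>i<p. q i < p"
    and rs: "\<forall>i<p. \<exists>r s. (\<forall>j<p. q j \<le> r j \<and> r j \<le> q j + 1) \<and>
                          (\<forall>j<p. q j \<le> s j \<and> s j \<le> q j + 1) \<and> label r i \<noteq> label s i"
  proof (rule kuhn_lemma[of p p label])
    show "\<forall>x. (\<forall>i<p. x i \<le> p) \<longrightarrow> (\<forall>i<p. x i = 0 \<longrightarrow> label x i = 0)"
    proof (intro allI impI)
      fix x i assume x: "\<forall>i<p. x i \<le> p" and "i < p" "x i = 0"
      with g[OF z[OF x]] \<open>0 < p\<close> show "label x i = 0"
        by (auto simp: label_def hilbert_cube_def z_def)
    qed
  qed (use \<open>0 < p\<close> in \<open>auto simp: label_def\<close>)
  have near: "\<bar>z r j - z q j\<bar> \<le> 1 / real p" if "\<forall>j<p. q j \<le> r j \<and> r j \<le> q j + 1" for r j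
  proof (cases "j < p")
    case True
    then have "real (q j) \<le> real (r j)" "real (r j) \<le> real (q j) + 1"
      using that by (auto simp flip: of_nat_Suc)
    then have "\<bar>real (r j) - real (q j)\<bar> \<le> 1" by linarith
    then have "\<bar>real (r j) - real (q j)\<bar> / real p \<le> 1 / real p"
      by (intro divide_right_mono) auto
    then show ?thesis using True \<open>0 < p\<close>
      by (simp add: z_def abs_divide flip: diff_divide_distrib)
  qed (simp add: z_def)
  have in_cube: "z r \<in> hilbert_cube" if "\<forall>j<p. q j \<le> r j \<and> r j \<le> q j + 1" for r
    by (rule z) (use that q in \<open>fastforce\<close>)
  have low: "z x i \<le> g (z x) i" if "label x i = 0" for x i
    using that by (auto simp: label_def split: if_splits)
  have high: "g (z x) i \<le> z x i" if "label x i \<noteq> 0" "i < p" "z x \<in> hilbert_cube" for x i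
  proof (cases "x i < p")
    case False
    then have "1 \<le> z x i" using that \<open>0 < p\<close> by (simp add: z_def)
    then show ?thesis using g[OF that(3)] by (force simp: hilbert_cube_def dest: spec[of _ i])
  qed (use that in \<open>auto simp: label_def split: if_splits\<close>)
  show ?thesis
  proof (rule bexI[of _ "z q"], intro allI impI)
    fix i assume i: "i < p"
    then obtain r s where r: "\<forall>j<p. q j \<le> r j \<and> r j \<le> q j + 1"
      and s: "\<forall>j<p. q j \<le> s j \<and> s j \<le> q j + 1" and ne: "label r i \<noteq> label s i"
      using rs by blast
    show "\<exists>u\<in>hilbert_cube. \<exists>v\<in>hilbert_cube.
           (\<forall>j. \<bar>u j - z q j\<bar> \<le> 1 / real p) \<and> (\<forall>j. \<bar>v j - z q j\<bar> \<le> 1 / real p) \<and>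
           u i \<le> g u i \<and> g v i \<le> v i"
    proof (cases "label r i = 0")
      case True
      with ne show ?thesis
        using low[OF True] high[of s i] near r s in_cube i by (metis (no_types, lifting))
    next
      case False
      with ne have "label s i = 0" by (auto simp: label_def split: if_splits)
      with False show ?thesis
        using low[of s i] high[of r i] near r s in_cube i by (metis (no_types, lifting))
    qed
  qed (use q z in \<open>auto simp: less_imp_le\<close>)
qed

text \<open>
  In the product topology, points whose coordinates differ by at most \<open>1/p\<close> have the same limits. So a
  limit point of the approximate fixed points is also the limit of the nearby points at which
  \<open>g\<close> moves coordinate \<open>i\<close> up, and of those at which it moves it down; both inequalities survive in the
  limit.
\<close>
theorem hilbert_cube_fixed_point:
  assumes cont: "continuous_on hilbert_cube g"
    and g: "\<And>c. c \<in> hilbert_cube \<Longrightarrow> g c \<in> hilbert_cube"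
  obtains c where "c \<in> hilbert_cube" "g c = c"
proof -
  have "\<forall>n. \<exists>w\<in>hilbert_cube. \<forall>i<Suc n. \<exists>u\<in>hilbert_cube. \<exists>v\<in>hilbert_cube.
           (\<forall>j. \<bar>u j - w j\<bar> \<le> 1 / real (Suc n)) \<and> (\<forall>j. \<bar>v j - w j\<bar> \<le> 1 / real (Suc n)) \<and>
           u i \<le> g u i \<and> g v i \<le> v i"
    by (intro allI kuhn_approximate_fixed_point g) auto
  then obtain w where w: "\<And>n. w n \<in> hilbert_cube"
    and near: "\<And>n i. i < Suc n \<Longrightarrow> \<exists>u\<in>hilbert_cube. \<exists>v\<in>hilbert_cube.
           (\<forall>j. \<bar>u j - w n j\<bar> \<le> 1 / real (Suc n)) \<and> (\<forall>j. \<bar>v j - w n j\<bar> \<le> 1 / real (Suc n)) \<and>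
           u i \<le> g u i \<and> g v i \<le> v i"
    by metis
  have "\<forall>n i. \<exists>u v. i < Suc n \<longrightarrow> u \<in> hilbert_cube \<and> v \<in> hilbert_cube \<and>
           (\<forall>j. \<bar>u j - w n j\<bar> \<le> 1 / real (Suc n)) \<and> (\<forall>j. \<bar>v j - w n j\<bar> \<le> 1 / real (Suc n)) \<and>
           u i \<le> g u i \<and> g v i \<le> v i"
    using near by blast
  then obtain U V where UV: "\<And>n i. i < Suc n \<Longrightarrow> U n i \<in> hilbert_cube \<and> V n i \<in> hilbert_cube \<and>
           (\<forall>j. \<bar>U n i j - w n j\<bar> \<le> 1 / real (Suc n)) \<and> (\<forall>j. \<bar>V n i j - w n j\<bar> \<le> 1 / real (Suc n)) \<and>
           U n i i \<le> g (U n i) i \<and> g (V n i) i \<le> V n i i"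
    by metis
  obtain c \<rho> where c: "c \<in> hilbert_cube" and \<rho>: "strict_mono (\<rho> :: nat \<Rightarrow> nat)"
    and lim: "(w \<circ> \<rho>) \<longlonglongrightarrow> c"
    using compact_hilbert_cube w unfolding compact_def by metis
  have limj: "(\<lambda>n. w (\<rho> n) j) \<longlonglongrightarrow> c j" for j
    using lim by (simp add: tendsto_coordinatewise o_def)
  have inv0: "(\<lambda>n. 1 / real (Suc (\<rho> n))) \<longlonglongrightarrow> 0"
    using LIMSEQ_subseq_LIMSEQ[OF LIMSEQ_inverse_real_of_nat \<rho>] by (simp add: o_def inverse_eq_divide)
  have lim_near: "(\<lambda>n. Y n) \<longlonglongrightarrow> c"
    if Y: "\<forall>\<^sub>F n in sequentially. \<forall>j. \<bar>Y n j - w (\<rho> n) j\<bar> \<le> 1 / real (Suc (\<rho> n))" for Y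
    unfolding tendsto_coordinatewise
  proof
    fix j
    have "(\<lambda>n. Y n j - w (\<rho> n) j) \<longlonglongrightarrow> 0"
    proof (rule Lim_null_comparison[OF _ inv0])
      show "\<forall>\<^sub>F n in sequentially. norm (Y n j - w (\<rho> n) j) \<le> 1 / real (Suc (\<rho> n))"
        using Y by eventually_elim auto
    qed
    from tendsto_add[OF this limj[of j]] show "(\<lambda>n. Y n j) \<longlonglongrightarrow> c j" by simp
  qed
  have ev: "\<forall>\<^sub>F n in sequentially. i < Suc (\<rho> n)" for i
    using eventually_ge_at_top[of i] by eventually_elim (use seq_suble[OF \<rho>] le_trans le_imp_less_Suc in blast)
  have g_lim: "(\<lambda>n. g (Y n) i) \<longlonglongrightarrow> g c i"
    if "\<forall>\<^sub>F n in sequentially. Y n \<in> hilbert_cube" "Y \<longlonglongrightarrow> c" for Y i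
  proof -
    have "(\<lambda>n. g (Y n)) \<longlonglongrightarrow> g c"
      using continuous_on_tendsto_compose[OF cont that(2) c that(1)] .
    then show ?thesis by (simp add: tendsto_coordinatewise)
  qed
  have "g c i = c i" for i
  proof (rule antisym)
    have V: "(\<lambda>n. V (\<rho> n) i) \<longlonglongrightarrow> c"
      by (rule lim_near) (use ev[of i] in eventually_elim, use UV in blast)
    show "g c i \<le> c i"
    proof (rule tendsto_le[OF sequentially_bot])
      show "(\<lambda>n. V (\<rho> n) i i) \<longlonglongrightarrow> c i" using V by (simp add: tendsto_coordinatewise)
      show "(\<lambda>n. g (V (\<rho> n) i) i) \<longlonglongrightarrow> g c i"
        by (rule g_lim[OF _ V]) (use ev[of i] in eventually_elim, use UV in blast)
      show "\<forall>\<^sub>F n in sequentially. g (V (\<rho> n) i) i \<le> V (\<rho> n) i i"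
        using ev[of i] by eventually_elim (use UV in blast)
    qed
    have U: "(\<lambda>n. U (\<rho> n) i) \<longlonglongrightarrow> c"
      by (rule lim_near) (use ev[of i] in eventually_elim, use UV in blast)
    show "c i \<le> g c i"
    proof (rule tendsto_le[OF sequentially_bot])
      show "(\<lambda>n. U (\<rho> n) i i) \<longlonglongrightarrow> c i" using U by (simp add: tendsto_coordinatewise)
      show "(\<lambda>n. g (U (\<rho> n) i) i) \<longlonglongrightarrow> g c i"
        by (rule g_lim[OF _ U]) (use ev[of i] in eventually_elim, use UV in blast)
      show "\<forall>\<^sub>F n in sequentially. U (\<rho> n) i i \<le> g (U (\<rho> n) i) i"
        using ev[of i] by eventually_elim (use UV in blast)
    qed
  qed
  with c that show thesis by blast
qed

section \<open>Schauder's fixed point theorem\<close>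

text \<open>
  The Schauder projection replaces a point of \<open>D\<close> by a convex combination of the points of a finite
  \<open>e\<close>-net, with weights (\<open>bump\<close>) that vanish on points at distance \<open>e\<close> or more; this moves it by at
  most \<open>e\<close>. In terms of the weights, \<open>F\<close> followed by the projection is a continuous self-map of a cube.
\<close>
lemma schauder_approximate:
  fixes C D :: "'a::real_normed_vector set"
  assumes "convex C" "C \<noteq> {}" "D \<subseteq> C" "compact D" "continuous_on C F" "F ` C \<subseteq> D" "0 < e"
  obtains x where "x \<in> C" "dist (F x) x \<le> e"
proof -
  obtain k where k: "finite k" "k \<subseteq> D" "D \<subseteq> (\<Union>y\<in>k. ball y e)"
    using compactE_image[OF \<open>compact D\<close>, of D "\<lambda>y. ball y e"] \<open>0 < e\<close>
    by (metis (no_types, lifting) UN_I centre_in_ball open_ball subsetI)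
  obtain n y where y: "k = y ` {i. i < (n::nat)}" 
    using finite_imp_nat_seg_image_inj_on[OF k(1)] by blast
  have yD: "y i \<in> D" if "i < n" for i using k(2) y that by auto
  define bump where "bump i z = max 0 (e - dist z (y i))" for i z
  define S where "S z = (\<Sum>i<n. bump i z)" for z
  have bump0: "0 \<le> bump i z" for i z by (simp add: bump_def)
  have S_pos: "0 < S z" if "z \<in> D" for z
  proof -
    have "z \<in> (\<Union>i\<in>{i. i < n}. ball (y i) e)" using k(3) that unfolding y by blast
    then obtain i where i: "i < n" "dist (y i) z < e" by auto
    have "0 < bump i z" using i by (simp add: bump_def dist_commute)
    then show ?thesis unfolding S_def using i bump0 by (intro sum_pos2[of _ i]) auto
  qed
  obtain y0 where y0: "y0 \<in> C" using \<open>C \<noteq> {}\<close> by blast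
  \<comment> \<open>The divisor turns every point of the cube into weights of sum at most 1, and leaves weights of
    sum 1, such as those of a fixed point, unchanged.\<close>
  define pt where "pt c = y0 + (\<Sum>i<n. (c i / max 1 (\<Sum>i<n. c i)) *\<^sub>R (y i - y0))" for c :: "nat \<Rightarrow> real"
  define g where "g c = (\<lambda>i. if i < n then bump i (F (pt c)) / S (F (pt c)) else 0)" for c
  have pt_C: "pt c \<in> C" if "c \<in> hilbert_cube" for c
  proof -
    let ?s = "\<Sum>i<n. c i"
    have c0: "0 \<le> c i" for i using that by (simp add: hilbert_cube_def)
    have s0: "0 \<le> ?s" using c0 by (simp add: sum_nonneg)
    define m where "m = max 1 ?s"
    have m: "0 < m" "?s \<le> m" by (auto simp: m_def)
    \<comment> \<open>The missing weight goes to the base point.\<close>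
    define wt where "wt i = (if i < n then c i / m else 1 - ?s / m)" for i
    define v where "v i = (if i < n then y i else y0)" for i
    have "(\<Sum>i\<in>{..n}. wt i *\<^sub>R v i) \<in> C"
    proof (rule convex_sum)
      show "convex C" by fact
      show "(\<Sum>i\<in>{..n}. wt i) = 1"
        using m by (simp add: lessThan_Suc_atMost[symmetric] wt_def sum_divide_distrib)
      show "0 \<le> wt i" for i using m c0 by (auto simp: wt_def)
      show "v i \<in> C" for i using yD \<open>D \<subseteq> C\<close> y0 by (auto simp: v_def)
    qed simp
    also have "(\<Sum>i\<in>{..n}. wt i *\<^sub>R v i) = (\<Sum>i<n. (c i / m) *\<^sub>R y i) + (1 - ?s / m) *\<^sub>R y0"
      by (simp add: lessThan_Suc_atMost[symmetric] wt_def v_def)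
    also have "\<dots> = pt c"
      by (simp add: pt_def flip: m_def)
         (simp add: scaleR_right_diff_distrib sum_subtractf scaleR_left_diff_distrib sum_divide_distrib
             flip: scaleR_left.sum)
    finally show ?thesis .
  qed
  have cont_pt: "continuous_on hilbert_cube pt"
    unfolding pt_def by (intro continuous_intros continuous_on_subset[OF continuous_on_product_coordinates]) auto
  have FD: "F (pt c) \<in> D" if "c \<in> hilbert_cube" for c using pt_C[OF that] \<open>F ` C \<subseteq> D\<close> by blast
  have cont_F: "continuous_on hilbert_cube (\<lambda>c. F (pt c))"
    by (rule continuous_on_compose2[OF \<open>continuous_on C F\<close> cont_pt]) (use pt_C in blast)
  have "continuous_on hilbert_cube g"
  proof (rule continuous_on_coordinatewise_then_product)
    fix i
    show "continuous_on hilbert_cube (\<lambda>c. g c i)"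
    proof (cases "i < n")
      case True
      have "S (F (pt c)) \<noteq> 0" if "c \<in> hilbert_cube" for c using S_pos[OF FD[OF that]] by simp
      then show ?thesis
        using True unfolding g_def bump_def S_def
        by (simp, intro continuous_intros cont_F) auto
    qed (simp add: g_def)
  qed
  moreover have "g c \<in> hilbert_cube" if "c \<in> hilbert_cube" for c
  proof -
    have "bump i (F (pt c)) \<le> S (F (pt c))" if "i < n" for i
      unfolding S_def using bump0 that by (intro member_le_sum) auto
    then show ?thesis using S_pos[OF FD[OF that]] bump0 by (auto simp: g_def hilbert_cube_def)
  qed
  ultimately obtain c where c: "c \<in> hilbert_cube" "g c = c"
    by (rule hilbert_cube_fixed_point)
  define z where "z = F (pt c)"
  have zD: "z \<in> D" using FD c(1) by (simp add: z_def)
  have ci: "c i = bump i z / S z" if "i < n" for i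
    using c(2) that by (metis (no_types, lifting) g_def z_def)
  have sum1: "(\<Sum>i<n. bump i z / S z) = 1"
    using S_pos[OF zD] by (simp add: S_def flip: sum_divide_distrib)
  have "pt c = y0 + (\<Sum>i<n. (bump i z / S z) *\<^sub>R (y i - y0))"
    using sum1 by (simp add: pt_def ci)
  then have "pt c - z = (\<Sum>i<n. (bump i z / S z) *\<^sub>R (y i - z))"
    using sum1 by (simp add: scaleR_right_diff_distrib sum_subtractf flip: scaleR_left.sum)
  also have "norm \<dots> \<le> (\<Sum>i<n. (bump i z / S z) * e)"
  proof (rule sum_norm_le)
    fix i
    show "norm ((bump i z / S z) *\<^sub>R (y i - z)) \<le> bump i z / S z * e"
    proof (cases "dist z (y i) < e")
      case True
      then show ?thesis using bump0[of i z] S_pos[OF zD]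
        by (auto simp: dist_norm norm_minus_commute intro!: mult_left_mono divide_right_mono)
    qed (simp add: bump_def)
  qed
  also have "\<dots> = e" using sum1 by (simp only: sum_distrib_right[symmetric] mult_1_left)
  finally have "dist (F (pt c)) (pt c) \<le> e" by (simp add: z_def dist_norm norm_minus_commute)
  with pt_C[OF c(1)] show thesis by (rule that)
qed

theorem schauder:
  fixes C D :: "'a::real_normed_vector set"
  assumes "convex C" "C \<noteq> {}" "D \<subseteq> C" "compact D" "continuous_on C F" "F ` C \<subseteq> D"
  obtains x where "x \<in> C" "F x = x"
proof -
  have "\<exists>x. x \<in> C \<and> dist (F x) x \<le> 1 / real (Suc n)" for n
    using schauder_approximate[OF assms, of "1 / real (Suc n)"] by auto
  then obtain X where X: "\<And>n. X n \<in> C" "\<And>n. dist (F (X n)) (X n) \<le> 1 / real (Suc n)"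
    by metis
  have "\<forall>n. (F \<circ> X) n \<in> D" using X(1) assms by auto
  then obtain l \<rho> where l: "l \<in> D" and \<rho>: "strict_mono (\<rho> :: nat \<Rightarrow> nat)"
    and lim: "((F \<circ> X) \<circ> \<rho>) \<longlonglongrightarrow> l"
    using \<open>compact D\<close>[unfolded compact_def, rule_format, of "F \<circ> X"] by blast
  have lim: "(\<lambda>n. F (X (\<rho> n))) \<longlonglongrightarrow> l" using lim by (simp add: o_def)
  have inv0: "(\<lambda>n. 1 / real (Suc (\<rho> n))) \<longlonglongrightarrow> 0"
    using LIMSEQ_subseq_LIMSEQ[OF LIMSEQ_inverse_real_of_nat \<rho>] by (simp add: o_def inverse_eq_divide)
  have "(\<lambda>n. F (X (\<rho> n)) - X (\<rho> n)) \<longlonglongrightarrow> 0"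
    by (rule Lim_null_comparison[OF _ inv0]) (use X(2) in \<open>auto simp: dist_norm\<close>)
  from tendsto_diff[OF lim this] have limX: "(\<lambda>n. X (\<rho> n)) \<longlonglongrightarrow> l" by simp
  have "(\<lambda>n. F (X (\<rho> n))) \<longlonglongrightarrow> F l"
    by (rule continuous_on_tendsto_compose[OF \<open>continuous_on C F\<close> limX])
       (use l X(1) \<open>D \<subseteq> C\<close> in auto)
  then have "F l = l" using lim LIMSEQ_unique by blast
  with l \<open>D \<subseteq> C\<close> that show thesis by blast
qed

section \<open>Krasnoselskii's fixed point theorem on a cone\<close>

text \<open>
  The size of an element of the cone is measured by a sublinear functional \<open>\<nu>\<close> that may differ from the
  norm of the space; the norm provides only the topology.
\<close>
locale gauged_cone =
  fixes K :: "'a::real_normed_vector set" and \<nu> :: "'a \<Rightarrow> real"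
  assumes convex_K: "convex K"
    and scale_K: "\<lbrakk>x \<in> K; 0 \<le> c\<rbrakk> \<Longrightarrow> c *\<^sub>R x \<in> K"
    and pointed_K: "\<lbrakk>x \<in> K; - x \<in> K\<rbrakk> \<Longrightarrow> x = 0"
    and nontrivial_K: "\<exists>e\<in>K. e \<noteq> 0"
    and cont_\<nu>: "continuous_on K \<nu>"
    and \<nu>_scale: "\<lbrakk>x \<in> K; 0 \<le> c\<rbrakk> \<Longrightarrow> \<nu> (c *\<^sub>R x) = c * \<nu> x"
    and \<nu>_add: "\<lbrakk>x \<in> K; y \<in> K\<rbrakk> \<Longrightarrow> \<nu> (x + y) \<le> \<nu> x + \<nu> y"
    and \<nu>_pos: "\<lbrakk>x \<in> K; x \<noteq> 0\<rbrakk> \<Longrightarrow> 0 < \<nu> x"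
begin

lemma zero_K: "0 \<in> K" and \<nu>_zero: "\<nu> 0 = 0"
proof -
  obtain e where "e \<in> K" using nontrivial_K by blast
  from scale_K[OF this, of 0] \<nu>_scale[OF this, of 0] show "0 \<in> K" "\<nu> 0 = 0" by auto
qed

lemma add_K:
  assumes "x \<in> K" "y \<in> K"
  shows "x + y \<in> K"
proof -
  have "2 *\<^sub>R ((1/2) *\<^sub>R x + (1/2) *\<^sub>R y) \<in> K"
    by (intro scale_K convexD[OF convex_K]) (use assms in auto)
  then show ?thesis by (simp add: scaleR_right_distrib)
qed

lemma convex_gauge_ball: "convex {x \<in> K. \<nu> x \<le> R}"
proof (rule convexI)
  fix x y and u v :: real
  assume *: "x \<in> {x \<in> K. \<nu> x \<le> R}" "y \<in> {x \<in> K. \<nu> x \<le> R}" "0 \<le> u" "0 \<le> v" "u + v = 1"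
  then have "\<nu> (u *\<^sub>R x + v *\<^sub>R y) \<le> u * \<nu> x + v * \<nu> y"
    using \<nu>_add[of "u *\<^sub>R x" "v *\<^sub>R y"] by (simp add: scale_K \<nu>_scale)
  also have "\<dots> \<le> u * R + v * R"
    using * by (intro add_mono mult_left_mono) auto
  also have "\<dots> = R" using * by (simp flip: distrib_right)
  finally show "u *\<^sub>R x + v *\<^sub>R y \<in> {x \<in> K. \<nu> x \<le> R}"
    using * by (auto intro: add_K scale_K)
qed

text \<open>
  The map \<open>\<pi>\<close> retracts the ball \<open>\<nu> \<le> R\<close> of the cone to the annulus: it pushes points with \<open>\<nu> x < r\<close> in a
  fixed direction \<open>e\<close> of the cone and rescales them to \<open>\<nu> = r\<close>. The push cannot produce \<open>0\<close>, since the
  cone is pointed. The map \<open>\<rho>\<close> retracts the cone radially to the ball. Schauder's theorem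
  applies to \<open>\<rho> \<circ> F \<circ> \<pi>\<close>, and the two boundary conditions exclude fixed points at which \<open>\<pi>\<close> or \<open>\<rho>\<close>
  acts nontrivially.
\<close>
theorem krasnoselskii_compression:
  assumes "0 < r" "r \<le> R" and D: "D \<subseteq> K" "compact D"
    and cont: "continuous_on {x \<in> K. r \<le> \<nu> x \<and> \<nu> x \<le> R} F"
    and F: "\<And>x. \<lbrakk>x \<in> K; r \<le> \<nu> x; \<nu> x \<le> R\<rbrakk> \<Longrightarrow> F x \<in> D"
    and lower: "\<And>x. \<lbrakk>x \<in> K; \<nu> x = r\<rbrakk> \<Longrightarrow> r \<le> \<nu> (F x)"
    and upper: "\<And>x. \<lbrakk>x \<in> K; \<nu> x = R\<rbrakk> \<Longrightarrow> \<nu> (F x) \<le> R"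
  obtains x where "x \<in> K" "r \<le> \<nu> x" "\<nu> x \<le> R" "F x = x"
proof -
  obtain e where e: "e \<in> K" "e \<noteq> 0" using nontrivial_K by blast
  define C where "C = {x \<in> K. \<nu> x \<le> R}"
  define w where "w x = x + max 0 (r - \<nu> x) *\<^sub>R e" for x
  define \<pi> where "\<pi> x = (max r (\<nu> x) / \<nu> (w x)) *\<^sub>R w x" for x
  define \<rho> where "\<rho> z = (R / max R (\<nu> z)) *\<^sub>R z" for z
  have R: "0 < R" using assms by linarith
  have wK: "w x \<in> K" if "x \<in> K" for x unfolding w_def using that e by (intro add_K scale_K) auto
  have w_pos: "0 < \<nu> (w x)" if "x \<in> K" for x
  proof (cases "r \<le> \<nu> x")
    case True
    then show ?thesis using \<open>0 < r\<close> by (simp add: w_def)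
  next
    case False
    have "w x \<noteq> 0"
    proof
      assume "w x = 0"
      then have neg: "- x = (r - \<nu> x) *\<^sub>R e" using False by (intro minus_unique) (simp add: w_def)
      then have "x = 0" using pointed_K[OF that] scale_K[OF e(1), of "r - \<nu> x"] False by simp
      then show False using neg e \<open>0 < r\<close> \<nu>_zero by simp
    qed
    then show ?thesis using \<nu>_pos wK that by blast
  qed
  have \<pi>_K: "\<pi> x \<in> K" and \<nu>_\<pi>: "\<nu> (\<pi> x) = max r (\<nu> x)" if "x \<in> K" for x
    using w_pos[OF that] wK[OF that] \<open>0 < r\<close> by (auto simp: \<pi>_def scale_K \<nu>_scale)
  have \<pi>_id: "\<pi> x = x" if "x \<in> K" "r \<le> \<nu> x" for x
    using that \<open>0 < r\<close> by (simp add: \<pi>_def w_def)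
  have cont_w: "continuous_on C w"
    unfolding w_def by (intro continuous_intros continuous_on_subset[OF cont_\<nu>]) (auto simp: C_def)
  have cont_\<pi>: "continuous_on C \<pi>"
    unfolding \<pi>_def
    by (intro continuous_intros cont_w continuous_on_subset[OF cont_\<nu>]
          continuous_on_compose2[OF cont_\<nu> cont_w])
       (use w_pos wK in \<open>force simp: C_def\<close>)+
  have \<pi>_ann: "r \<le> \<nu> (\<pi> x)" "\<nu> (\<pi> x) \<le> R" if "x \<in> C" for x
    using that assms by (auto simp: C_def \<nu>_\<pi>)
  have cont_\<rho>: "continuous_on K \<rho>"
    unfolding \<rho>_def by (intro continuous_intros cont_\<nu>) (use R in auto)
  have \<rho>_K: "\<rho> z \<in> K" and \<nu>_\<rho>: "\<nu> (\<rho> z) = min R (\<nu> z)" if "z \<in> K" for z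
    using R that by (auto simp: \<rho>_def scale_K \<nu>_scale max_def min_def)
  have FD: "F (\<pi> x) \<in> D" if "x \<in> C" for x
    by (rule F) (use that \<pi>_ann \<pi>_K in \<open>auto simp: C_def\<close>)
  obtain x where x: "x \<in> C" "\<rho> (F (\<pi> x)) = x"
  proof (rule schauder[of C "\<rho> ` D" "\<lambda>x. \<rho> (F (\<pi> x))"])
    show "convex C" unfolding C_def by (rule convex_gauge_ball)
    show "C \<noteq> {}" using zero_K \<nu>_zero R by (auto simp: C_def)
    show "\<rho> ` D \<subseteq> C" using D \<rho>_K \<nu>_\<rho> by (auto simp: C_def)
    show "compact (\<rho> ` D)"
      by (intro compact_continuous_image continuous_on_subset[OF cont_\<rho>] D)
    have "continuous_on C (\<lambda>x. F (\<pi> x))"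
      by (rule continuous_on_compose2[OF cont cont_\<pi>]) (use \<pi>_ann \<pi>_K in \<open>auto simp: C_def\<close>)
    then show "continuous_on C (\<lambda>x. \<rho> (F (\<pi> x)))"
      by (rule continuous_on_compose2[OF cont_\<rho>]) (use FD D in auto)
  qed (use FD in blast)
  have xK: "x \<in> K" using x by (simp add: C_def)
  have FK: "F (\<pi> x) \<in> K" using FD x D by blast
  have \<nu>x: "\<nu> x = min R (\<nu> (F (\<pi> x)))" using \<nu>_\<rho>[OF FK] x by simp
  have "r \<le> \<nu> x"
  proof (rule ccontr)
    assume "\<not> r \<le> \<nu> x"
    then have "r \<le> \<nu> (F (\<pi> x))" by (intro lower) (simp_all add: \<pi>_K \<nu>_\<pi> xK)
    with \<nu>x \<open>\<not> r \<le> \<nu> x\<close> \<open>r \<le> R\<close> show False by simp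
  qed
  moreover from this have "\<pi> x = x" using \<pi>_id xK by blast
  moreover have "\<nu> (F x) \<le> R"
    using upper[OF xK] \<nu>x \<open>\<pi> x = x\<close> by (cases "\<nu> (F x) \<le> R") auto
  ultimately show thesis using x xK R that[of x] by (simp add: C_def \<rho>_def max_def split: if_splits)
qed

text \<open>
  The map \<open>G x = (\<nu> x / \<nu> (F x))\<^sup>2 F x\<close> has the same fixed points as \<open>F\<close>, but
  \<open>\<nu> (G x) = (\<nu> x)\<^sup>2 / \<nu> (F x)\<close> is larger than \<open>\<nu> x\<close> exactly where \<open>\<nu> (F x)\<close> is smaller. So \<open>G\<close> is
  compressive when \<open>F\<close> is expansive. The lower bound \<open>\<delta>\<close> keeps the range of \<open>G\<close> relatively compact.
\<close>
theorem krasnoselskii_expansion: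
  assumes "0 < r" "r \<le> R" and D: "D \<subseteq> K" "compact D"
    and cont: "continuous_on {x \<in> K. r \<le> \<nu> x \<and> \<nu> x \<le> R} F"
    and F: "\<And>x. \<lbrakk>x \<in> K; r \<le> \<nu> x; \<nu> x \<le> R\<rbrakk> \<Longrightarrow> F x \<in> D"
    and "0 < \<delta>" and F_bound: "\<And>x. \<lbrakk>x \<in> K; r \<le> \<nu> x; \<nu> x \<le> R\<rbrakk> \<Longrightarrow> \<delta> \<le> \<nu> (F x)"
    and upper: "\<And>x. \<lbrakk>x \<in> K; \<nu> x = r\<rbrakk> \<Longrightarrow> \<nu> (F x) \<le> r"
    and lower: "\<And>x. \<lbrakk>x \<in> K; \<nu> x = R\<rbrakk> \<Longrightarrow> R \<le> \<nu> (F x)"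
  obtains x where "x \<in> K" "r \<le> \<nu> x" "\<nu> x \<le> R" "F x = x"
proof -
  let ?A = "{x \<in> K. r \<le> \<nu> x \<and> \<nu> x \<le> R}"
  define S where "S p = (fst p / max \<delta> (\<nu> (snd p)))\<^sup>2 *\<^sub>R snd p" for p :: "real \<times> 'a"
  define G where "G x = S (\<nu> x, F x)" for x
  have cont_S: "continuous_on (UNIV \<times> K) S"
    unfolding S_def
    by (intro continuous_intros continuous_on_compose2[OF cont_\<nu>]) (use \<open>0 < \<delta>\<close> in auto)
  have FK: "F x \<in> K" if "x \<in> ?A" for x using F D that by blast
  have \<nu>G: "\<nu> (G x) = (\<nu> x)\<^sup>2 / \<nu> (F x)" if "x \<in> ?A" for x
    using F_bound[of x] \<open>0 < \<delta>\<close> FK[OF that] that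
    by (simp add: G_def S_def \<nu>_scale max_def power2_eq_square)
  obtain x where x: "x \<in> K" "r \<le> \<nu> x" "\<nu> x \<le> R" "G x = x"
  proof (rule krasnoselskii_compression[of r R "S ` ({r..R} \<times> D)" G])
    show "S ` ({r..R} \<times> D) \<subseteq> K" using D by (auto simp: S_def intro!: scale_K)
    show "compact (S ` ({r..R} \<times> D))"
      by (intro compact_continuous_image continuous_on_subset[OF cont_S] compact_Times D)
         (use D in auto)
    show "continuous_on ?A G"
      unfolding G_def
      by (rule continuous_on_compose2[OF cont_S])
         (use FK in \<open>auto intro!: continuous_intros cont continuous_on_subset[OF cont_\<nu>]\<close>)
    show "G x \<in> S ` ({r..R} \<times> D)" if "x \<in> K" "r \<le> \<nu> x" "\<nu> x \<le> R" for x
      using F[OF that] that by (auto simp: G_def)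
    show "r \<le> \<nu> (G x)" if "x \<in> K" "\<nu> x = r" for x
    proof -
      have "0 < \<nu> (F x)" using less_le_trans[OF \<open>0 < \<delta>\<close> F_bound[of x]] that \<open>r \<le> R\<close> by simp
      moreover have "r * \<nu> (F x) \<le> r\<^sup>2"
        using upper[OF that] \<open>0 < r\<close> by (simp add: power2_eq_square)
      ultimately show ?thesis using \<nu>G[of x] that \<open>r \<le> R\<close> by (simp add: pos_le_divide_eq)
    qed
    show "\<nu> (G x) \<le> R" if "x \<in> K" "\<nu> x = R" for x
    proof -
      have "0 < \<nu> (F x)" using less_le_trans[OF \<open>0 < \<delta>\<close> F_bound[of x]] that \<open>r \<le> R\<close> by simp
      moreover have "R\<^sup>2 \<le> R * \<nu> (F x)"
        using lower[OF that] assms(1,2) by (simp add: power2_eq_square)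
      ultimately show ?thesis using \<nu>G[of x] that \<open>r \<le> R\<close> by (simp add: pos_divide_le_eq)
    qed
  qed (use assms in auto)
  have pos: "0 < \<nu> x" "0 < \<nu> (F x)" using x F_bound[of x] \<open>0 < \<delta>\<close> \<open>0 < r\<close> by auto
  have "\<nu> x = (\<nu> x)\<^sup>2 / \<nu> (F x)" using \<nu>G[of x] x by simp
  then have "\<nu> (F x) = \<nu> x" using pos by (simp add: field_simps power2_eq_square)
  then have "G x = F x" using pos F_bound[OF x(1-3)] by (simp add: G_def S_def max_def)
  then show thesis using x that by simp
qed

end

section \<open>The scalar linear equation with periodic forcing\<close>

text \<open>
  An antiderivative on the whole line; the integral over \<open>{0..t}\<close> alone would be constant on the
  negative half line.
\<close>
definition prim :: "(real \<Rightarrow> real) \<Rightarrow> real \<Rightarrow> real" where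
  "prim g t = integral {0..t} g - integral {t..0} g"

lemma prim_0 [simp]: "prim g 0 = 0"
  by (simp add: prim_def)

lemma prim_eq_integral: "0 \<le> t \<Longrightarrow> prim g t = integral {0..t} g"
  by (cases "t = 0") (auto simp: prim_def)

lemma has_real_derivative_prim:
  assumes "continuous_on UNIV g"
  shows "(prim g has_real_derivative g t) (at t)"
proof -
  define N where "N = \<bar>t\<bar> + 1"
  have cont: "continuous_on S g" for S using assms continuous_on_subset by blast
  have int: "g integrable_on {u..v}" for u v using cont by (rule integrable_continuous_interval)
  \<comment> \<open>On a bounded interval \<open>prim g\<close> is an ordinary integral from its left end, up to a constant.\<close>
  have eq: "prim g s = integral {-N..s} g - integral {-N..0} g" if "s \<in> {-N<..<N}" for s
  proof (cases "0 \<le> s")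
    case True
    then show ?thesis
      using Henstock_Kurzweil_Integration.integral_combine[of "-N" 0 s g] int
      by (simp add: prim_eq_integral N_def eq_diff_eq add.commute)
  next
    case False
    then show ?thesis
      using Henstock_Kurzweil_Integration.integral_combine[of "-N" s 0 g] int that
      by (simp add: prim_def)
  qed
  have t: "t \<in> {-N<..<N}" by (auto simp: N_def)
  have "((\<lambda>s. integral {-N..s} g) has_real_derivative g t) (at t within {-N..N})"
    using t by (intro integral_has_real_derivative cont) auto
  then have "((\<lambda>s. integral {-N..s} g) has_real_derivative g t) (at t)"
    using t by (simp add: at_within_Icc_at)
  then have "((\<lambda>s. integral {-N..s} g - integral {-N..0} g) has_real_derivative g t) (at t)"
    by (auto intro!: derivative_eq_intros)
  then show ?thesis
    by (rule DERIV_cong_ev[THEN iffD1, rotated -1])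
       (use t eventually_nhds_in_open[OF open_greaterThanLessThan t] eq in \<open>auto elim!: eventually_mono\<close>)
qed

lemma DERIV_prim_chain [derivative_intros]:
  assumes "continuous_on UNIV g" "(u has_real_derivative u') (at t within S)" "D = g (u t) * u'"
  shows "((\<lambda>t. prim g (u t)) has_real_derivative D) (at t within S)"
  using DERIV_chain2[OF has_real_derivative_prim[OF assms(1)] assms(2)] assms(3) by simp

lemma constant_if_zero_derivative:
  fixes g :: "real \<Rightarrow> real"
  assumes "\<And>t. (g has_real_derivative 0) (at t)"
  shows "g s = g t"
  using DERIV_isconst_all[of g] assms by blast

lemma prim_add_period:
  assumes "continuous_on UNIV g" "periodic w g"
  shows "prim g (t + w) = prim g t + prim g w"
proof -
  have "((\<lambda>t. prim g (t + w) - prim g t) has_real_derivative 0) (at s)" for s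
    using assms by (auto intro!: derivative_eq_intros simp: periodic_def)
  from constant_if_zero_derivative[OF this, of t 0] show ?thesis by simp
qed

lemma prim_mono_diff:
  assumes "continuous_on UNIV g" "continuous_on UNIV h" "s \<le> t"
    and "\<And>u. \<lbrakk>s \<le> u; u \<le> t\<rbrakk> \<Longrightarrow> g u \<le> h u"
  shows "prim g t - prim g s \<le> prim h t - prim h s"
proof -
  have "(\<lambda>t. prim h t - prim g t) s \<le> (\<lambda>t. prim h t - prim g t) t"
  proof (rule DERIV_nonneg_imp_nondecreasing[OF \<open>s \<le> t\<close>])
    fix u assume "s \<le> u" "u \<le> t"
    then show "\<exists>y. ((\<lambda>t. prim h t - prim g t) has_real_derivative y) (at u) \<and> 0 \<le> y"
      using assms by (intro exI[of _ "h u - g u"]) (auto intro!: derivative_eq_intros)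
  qed
  then show ?thesis by simp
qed

lemma prim_const_mult:
  assumes "continuous_on UNIV g"
  shows "prim (\<lambda>t. c * g t) t = c * prim g t"
proof -
  have "((\<lambda>t. prim (\<lambda>t. c * g t) t - c * prim g t) has_real_derivative 0) (at s)" for s
    using assms by (auto intro!: derivative_eq_intros continuous_intros)
  from constant_if_zero_derivative[OF this, of t 0] show ?thesis by simp
qed

locale periodic_decay =
  fixes w :: real and a :: "real \<Rightarrow> real"
  assumes w: "0 < w"
    and cont_a: "continuous_on UNIV a" and a_nonneg: "0 \<le> a t"
    and per_a: "periodic w a" and mean_a: "0 < mean w a"
begin

text \<open>
  The factor by which the integrating factor \<open>exp (prim a)\<close> grows over one period; it is the
  inverse of \<open>\<sigma>\<^sub>i\<close>.
\<close>
definition E :: real where "E = exp (prim a w)"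

text \<open>
  The candidate for the periodic solution of \<open>y' = -a y + h\<close>, that is,
  the integral of \<open>exp(prim a s - prim a t) h(s) / (E - 1)\<close> over \<open>s\<close> from \<open>t\<close> to \<open>t + w\<close>.
\<close>
definition response :: "(real \<Rightarrow> real) \<Rightarrow> real \<Rightarrow> real" where
  "response h t = exp (- prim a t) / (E - 1) *
     (prim (\<lambda>s. exp (prim a s) * h s) (t + w) - prim (\<lambda>s. exp (prim a s) * h s) t)"

lemma E_gt_1: "1 < E"
  using mean_a w by (simp add: E_def mean_def prim_eq_integral zero_less_divide_iff)

lemma E_eq_mean: "E = exp (mean w a * w)"
  using w by (simp add: E_def mean_def prim_eq_integral)

lemma exp_prim_add_period: "exp (prim a (t + w)) = E * exp (prim a t)"
  using prim_add_period[OF cont_a per_a] by (simp add: E_def exp_add)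

lemma cont_prim_a: "continuous_on S (prim a)"
  by (rule DERIV_continuous_on[OF DERIV_subset[OF has_real_derivative_prim[OF cont_a]]]) auto

lemma cont_weighted: "continuous_on UNIV h \<Longrightarrow> continuous_on UNIV (\<lambda>s. exp (prim a s) * h s)"
  by (intro continuous_intros cont_prim_a)

text \<open>
  The derivative of \<open>exp (prim a) y\<close> is \<open>exp (prim a) h\<close>. Comparing its values at \<open>t\<close> and \<open>t + w\<close>,
  where \<open>y\<close> is the same but the integrating factor is multiplied by \<open>E \<noteq> 1\<close>, determines \<open>y t\<close>.
\<close>
lemma response_unique:
  assumes h: "continuous_on UNIV h"
    and y: "\<And>t. (y has_real_derivative - a t * y t + h t) (at t)" and per: "periodic w y"
  shows "y = response h"
proof
  fix t
  let ?H = "prim (\<lambda>s. exp (prim a s) * h s)"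
  have "((\<lambda>t. exp (prim a t) * y t - ?H t) has_real_derivative 0) (at s)" for s
    by (rule derivative_eq_intros refl y cont_a cont_weighted h)+ (simp add: algebra_simps)
  from constant_if_zero_derivative[OF this, of "t + w" t]
  have "?H (t + w) - ?H t = exp (prim a t) * y t * (E - 1)"
    using per by (simp add: exp_prim_add_period periodic_def algebra_simps)
  then show "y t = response h t"
    using E_gt_1 by (simp add: response_def exp_minus)
qed

lemma response_derivative:
  assumes h: "continuous_on UNIV h" and per: "periodic w h"
  shows "(response h has_real_derivative - a t * response h t + h t) (at t)"
proof -
  let ?H = "prim (\<lambda>s. exp (prim a s) * h s)"
  let ?y = "\<lambda>t. exp (- prim a t) * (?H (t + w) - ?H t)"
  have "exp (- prim a t) * (exp (prim a (t + w)) * h (t + w) - exp (prim a t) * h t) = (E - 1) * h t"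
    using per by (simp add: exp_prim_add_period periodic_def exp_minus field_simps)
  moreover have "(?y has_real_derivative
      - a t * ?y t + exp (- prim a t) * (exp (prim a (t + w)) * h (t + w) - exp (prim a t) * h t)) (at t)"
    by (rule derivative_eq_intros refl cont_a cont_weighted h)+ (simp add: algebra_simps)
  ultimately have "(?y has_real_derivative - a t * ?y t + (E - 1) * h t) (at t)" by simp
  from DERIV_cmult[OF this, of "1 / (E - 1)"]
  have "((\<lambda>t. 1 / (E - 1) * ?y t) has_real_derivative 1 / (E - 1) * (- a t * ?y t + (E - 1) * h t)) (at t)" .
  moreover have "(\<lambda>t. 1 / (E - 1) * ?y t) = response h"
    by (simp add: response_def fun_eq_iff)
  moreover have "1 / (E - 1) * (- a t * ?y t + (E - 1) * h t) = - a t * response h t + h t"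
    using E_gt_1 by (simp add: response_def diff_divide_distrib)
  ultimately show ?thesis by simp
qed

lemma response_periodic:
  assumes h: "continuous_on UNIV h" and per: "periodic w h"
  shows "periodic w (response h)"
  unfolding periodic_def
proof
  fix t
  let ?H = "prim (\<lambda>s. exp (prim a s) * h s)"
  have "((\<lambda>t. (?H (t + w) - E * ?H t)) has_real_derivative 0) (at s)" for s
    using per by (auto intro!: derivative_eq_intros cont_weighted h simp: exp_prim_add_period periodic_def)
  from constant_if_zero_derivative[OF this, of "t + w" t]
  have "?H (t + w + w) - ?H (t + w) = E * (?H (t + w) - ?H t)"
    by (simp add: algebra_simps)
  moreover have "exp (- prim a (t + w)) = exp (- prim a t) / E"
    by (simp add: exp_minus exp_prim_add_period field_simps)
  ultimately show "response h (t + w) = response h t"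
    using E_gt_1 by (simp add: response_def)
qed

text \<open>
  Linearity is read off from uniqueness instead of computing with the integral formula.
\<close>
lemma response_diff:
  assumes "continuous_on UNIV g" "periodic w g" "continuous_on UNIV h" "periodic w h"
  shows "response (\<lambda>t. g t - h t) t = response g t - response h t"
proof -
  have "(\<lambda>t. response g t - response h t) = response (\<lambda>t. g t - h t)"
  proof (rule response_unique)
    show "periodic w (\<lambda>t. response g t - response h t)"
      using response_periodic[of g] response_periodic[of h] assms by (simp add: periodic_def)
    show "((\<lambda>t. response g t - response h t) has_real_derivative
            - a t * (response g t - response h t) + (g t - h t)) (at t)" for t
      using response_derivative[of g t] response_derivative[of h t] assms
      by (auto intro!: derivative_eq_intros simp: algebra_simps)
  qed (use assms in \<open>auto intro: continuous_intros\<close>)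
  then show ?thesis by metis
qed

text \<open>
  Over the window from \<open>t\<close> to \<open>t + w\<close> the monotone factor \<open>exp (prim a)\<close> lies between its value at
  \<open>t\<close> and \<open>E\<close> times that value, and the integral of \<open>h\<close> over any window of length \<open>w\<close> is the same.
\<close>
lemma response_bounds:
  assumes h: "continuous_on UNIV h" and per: "periodic w h" and pos: "\<And>t. 0 \<le> h t"
  shows "prim h w / (E - 1) \<le> response h t" and "response h t \<le> E / (E - 1) * prim h w"
proof -
  let ?H = "prim (\<lambda>s. exp (prim a s) * h s)"
  have mono: "prim a u \<le> prim a v" if "u \<le> v" for u v
    using prim_mono_diff[of "\<lambda>_. 0" a u v] that a_nonneg cont_a prim_const_mult[of "\<lambda>_. 0" 0] by simp
  have shift: "prim h (t + w) - prim h t = prim h w" using prim_add_period[OF h per] by simp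
  have "exp (prim a t) * prim h w \<le> ?H (t + w) - ?H t"
    using prim_mono_diff[of "\<lambda>s. exp (prim a t) * h s" "\<lambda>s. exp (prim a s) * h s" t "t + w"]
      cont_weighted h w pos mono shift
    by (auto simp: prim_const_mult mult_right_mono continuous_on_mult_left simp flip: right_diff_distrib)
  then have "exp (prim a t) * prim h w * (exp (- prim a t) / (E - 1))
      \<le> (?H (t + w) - ?H t) * (exp (- prim a t) / (E - 1))"
    using E_gt_1 by (intro mult_right_mono) auto
  also have "\<dots> = response h t" by (simp add: response_def)
  finally show "prim h w / (E - 1) \<le> response h t"
    by (simp add: exp_minus mult.commute mult.left_commute)
  have "?H (t + w) - ?H t \<le> exp (prim a (t + w)) * prim h w"
    using prim_mono_diff[of "\<lambda>s. exp (prim a s) * h s" "\<lambda>s. exp (prim a (t + w)) * h s" t "t + w"]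
      cont_weighted h w pos mono shift
    by (auto simp: prim_const_mult mult_right_mono continuous_on_mult_left simp flip: right_diff_distrib)
  then have "(?H (t + w) - ?H t) * (exp (- prim a t) / (E - 1))
      \<le> E * exp (prim a t) * prim h w * (exp (- prim a t) / (E - 1))"
    using E_gt_1 by (intro mult_right_mono) (auto simp: exp_prim_add_period)
  also have "\<dots> = E / (E - 1) * prim h w" by (simp add: exp_minus)
  also have "(?H (t + w) - ?H t) * (exp (- prim a t) / (E - 1)) = response h t"
    by (simp add: response_def)
  finally show "response h t \<le> E / (E - 1) * prim h w" .
qed

lemma prim_nonneg:
  assumes "continuous_on UNIV h" "\<And>t. 0 \<le> h t"
  shows "0 \<le> prim h w"
  using prim_mono_diff[of "\<lambda>_. 0" h 0 w] assms w prim_const_mult[of "\<lambda>_. 0" 0] by simp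

lemma response_nonneg:
  assumes "continuous_on UNIV h" "periodic w h" "\<And>t. 0 \<le> h t"
  shows "0 \<le> response h t"
  using response_bounds(1)[OF assms, of t] prim_nonneg[OF assms(1,3)] E_gt_1
  by (smt (verit) divide_nonneg_pos)

text \<open>
  The upper and lower bounds of the response differ by the factor \<open>E\<close> and do not depend on the time.
\<close>
lemma response_harnack:
  assumes "continuous_on UNIV h" "periodic w h" "\<And>t. 0 \<le> h t"
  shows "inverse E * response h s \<le> response h t"
proof -
  have "inverse E * response h s \<le> inverse E * (E / (E - 1) * prim h w)"
    using response_bounds(2)[OF assms] E_gt_1 by (intro mult_left_mono) auto
  also have "\<dots> = prim h w / (E - 1)" using E_gt_1 by simp
  also have "\<dots> \<le> response h t" by (rule response_bounds(1)[OF assms])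
  finally show ?thesis .
qed

lemma response_mono:
  assumes "continuous_on UNIV g" "periodic w g" "continuous_on UNIV h" "periodic w h" 
    and "\<And>t. g t \<le> h t"
  shows "response g t \<le> response h t"
  using response_nonneg[of "\<lambda>t. h t - g t" t] response_diff[of h g t] assms
  by (simp add: continuous_on_diff periodic_def)

lemma response_abs_diff_le:
  assumes g: "continuous_on UNIV g" "periodic w g" and h: "continuous_on UNIV h" "periodic w h"
    and k: "continuous_on UNIV k" "periodic w k" and "\<And>t. \<bar>g t - h t\<bar> \<le> k t"
  shows "\<bar>response g t - response h t\<bar> \<le> response k t"
proof -
  have diff: "response p t - response q t \<le> response k t"
    if "continuous_on UNIV p" "periodic w p" "continuous_on UNIV q" "periodic w q"
      "\<And>t. p t - q t \<le> k t" for p q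
    using response_mono[of "\<lambda>t. p t - q t" k t] response_diff[of p q t] that k
    by (simp add: continuous_on_diff periodic_def)
  have "g t - h t \<le> k t" "h t - g t \<le> k t" for t
    using assms(7)[of t] by (auto simp: abs_le_iff)
  with diff[OF g h] diff[OF h g] show ?thesis by (simp add: abs_le_iff)
qed

end

section \<open>Periodic functions, the orthant and its sum norm\<close>
lemma periodic_shift: "periodic w g \<Longrightarrow> g (t + of_int k * w) = g t"
proof -
  assume per: "periodic w g"
  have nat: "g (t + of_nat n * w) = g t" for n t
  proof (induction n)
    case (Suc n)
    have "g (t + of_nat (Suc n) * w) = g ((t + of_nat n * w) + w)" by (simp add: algebra_simps)
    then show ?case using Suc per by (simp add: periodic_def)
  qed simp
  show ?thesis
  proof (cases "0 \<le> k")
    case True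
    then show ?thesis using nat[of t "nat k"] by simp
  next
    case False
    then show ?thesis using nat[of "t + of_int k * w" "nat (- k)"] by simp
  qed
qed

definition wrap :: "real \<Rightarrow> real \<Rightarrow> real" where
  "wrap w t = t - of_int \<lfloor>t / w\<rfloor> * w"

lemma wrap_in_period: "0 < w \<Longrightarrow> wrap w t \<in> {0..w}"
proof -
  assume w: "0 < w"
  from floor_divide_lower[OF this, of t] floor_divide_upper[OF this, of t] show ?thesis
    by (simp add: wrap_def algebra_simps)
qed

lemma periodic_wrap: "periodic w g \<Longrightarrow> g (wrap w t) = g t"
  using periodic_shift[of w g t "- \<lfloor>t / w\<rfloor>"] by (simp add: wrap_def)

lemma continuous_periodic_bounded:
  fixes g :: "real \<Rightarrow> 'a::real_normed_vector"
  assumes "continuous_on UNIV g" "periodic w g" "0 < w"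
  shows "\<exists>B. \<forall>t. norm (g t) \<le> B"
proof -
  have "compact (g ` {0..w})"
    by (intro compact_continuous_image continuous_on_subset[OF assms(1)]) auto
  then obtain B where "\<forall>y\<in>g ` {0..w}. norm y \<le> B"
    using compact_imp_bounded bounded_iff by blast
  then have "norm (g t) \<le> B" for t
    using wrap_in_period[OF assms(3), of t] periodic_wrap[OF assms(2), of t] by (metis imageI)
  then show ?thesis by blast
qed

lemma l1norm_nonneg: "0 \<le> l1norm x"
  by (simp add: l1norm_def sum_nonneg)

lemma l1norm_eq_0_iff: "l1norm x = 0 \<longleftrightarrow> x = 0"
  by (simp add: l1norm_def sum_nonneg_eq_0_iff vec_eq_iff)

lemma l1norm_zero [simp]: "l1norm 0 = 0"
  by (simp add: l1norm_eq_0_iff)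

lemma l1norm_scaleR: "l1norm (c *\<^sub>R x) = \<bar>c\<bar> * l1norm x"
  by (simp add: l1norm_def abs_mult sum_distrib_left)

lemma l1norm_triangle: "l1norm (x + y) \<le> l1norm x + l1norm y"
  by (simp add: l1norm_def sum_mono flip: sum.distrib)

lemma component_le_l1norm: "\<bar>x $ i\<bar> \<le> l1norm x"
  unfolding l1norm_def by (rule member_le_sum) auto

lemma norm_le_l1norm: "norm x \<le> l1norm x"
  unfolding l1norm_def by (rule norm_le_l1_cart)

lemma l1norm_le_norm:
  fixes x :: "real ^ 'n::finite"
  shows "l1norm x \<le> real CARD('n) * norm x"
proof -
  have "l1norm x \<le> (\<Sum>i\<in>(UNIV::'n set). norm x)"
    unfolding l1norm_def by (intro sum_mono component_le_norm_cart)
  then show ?thesis by simp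
qed

lemma continuous_on_l1norm [continuous_intros]:
  "continuous_on S g \<Longrightarrow> continuous_on S (\<lambda>x. l1norm (g x))"
  unfolding l1norm_def by (intro continuous_intros)

lemma compact_orthant_shell: "compact {u \<in> orthant. c \<le> l1norm u \<and> l1norm u \<le> R}"
proof -
  have "closed {u :: real ^ 'n. (\<forall>i. 0 \<le> u $ i) \<and> c \<le> l1norm u \<and> l1norm u \<le> R}"
    by (intro closed_Collect_conj closed_Collect_all closed_Collect_le continuous_intros)
  moreover have "bounded {u :: real ^ 'n. (\<forall>i. 0 \<le> u $ i) \<and> c \<le> l1norm u \<and> l1norm u \<le> R}"
    unfolding bounded_iff using norm_le_l1norm order_trans by blast
  ultimately show ?thesis by (simp add: compact_eq_bounded_closed orthant_def)
qed

lemma compact_orthant_ball: "compact {u \<in> orthant. l1norm u \<le> R}"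
  using compact_orthant_shell[of 0 R] by (simp add: l1norm_nonneg)

lemma l1norm_axis: "l1norm (axis i c) = \<bar>c\<bar>"
  by (simp add: l1norm_def axis_def if_distrib cong: if_cong)

lemma axis_in_orthant: "0 \<le> c \<Longrightarrow> axis i c \<in> orthant"
  by (simp add: orthant_def axis_def)

lemma eventually_orthant_at_0:
  assumes "eventually P orthant_at_0"
  shows "\<exists>\<rho>>0. \<forall>u\<in>orthant. 0 < l1norm u \<longrightarrow> l1norm u < \<rho> \<longrightarrow> P u"
  using assms
  by (auto simp: orthant_at_0_def eventually_inf_principal eventually_filtercomap eventually_at_right_field)

lemma eventually_orthant_at_infinity:
  assumes "eventually P orthant_at_infinity"
  shows "\<exists>\<rho>. \<forall>u\<in>orthant. \<rho> \<le> l1norm u \<longrightarrow> P u"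
  using assms
  by (auto simp: orthant_at_infinity_def eventually_inf_principal eventually_filtercomap eventually_at_top_linorder)

lemma ennreal_between:
  fixes x y :: ennreal
  assumes "x < y"
  obtains c where "0 < c" "x < ennreal c" "ennreal c < y"
proof -
  obtain z where z: "x < z" "z < y" using dense[OF assms] by blast
  then obtain c where "0 \<le> c" "z = ennreal c" by (cases z) auto
  with z that[of c] show thesis by (cases "c = 0") auto
qed

text \<open>
  The size of a function on the cone. The supremum of the sum norm fits the constants of the theorem:
  \<open>M(r)\<close> bounds \<open>f\<close> along any nonnegative function of gauge \<open>r\<close>, and \<open>\<chi>\<close>, a sum over the components, bounds the
  response to it.
\<close>
definition gauge :: "(real \<Rightarrow> real ^ 'n::finite) \<Rightarrow> real" where
  "gauge x = (SUP t. l1norm (x t))"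

lemma gauge_upper:
  fixes x :: "real \<Rightarrow>\<^sub>C (real ^ 'n::finite)"
  shows "l1norm (x t) \<le> gauge x"
  unfolding gauge_def
proof (rule cSUP_upper)
  have "l1norm (x t) \<le> real CARD('n) * norm x" for t
    using l1norm_le_norm[of "x t"] norm_bounded[of x t]
    by (meson mult_left_mono of_nat_0_le_iff order_trans)
  then show "bdd_above (range (\<lambda>t. l1norm (x t)))" by (intro bdd_aboveI2)
qed simp

lemma gauge_least: "(\<And>t. l1norm (x t) \<le> B) \<Longrightarrow> gauge x \<le> B"
  unfolding gauge_def by (rule cSUP_least) auto

lemma gauge_le_iff:
  fixes x :: "real \<Rightarrow>\<^sub>C (real ^ 'n::finite)"
  shows "gauge (apply_bcontfun x) \<le> B \<longleftrightarrow> (\<forall>t. l1norm (apply_bcontfun x t) \<le> B)"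
  using gauge_upper gauge_least order_trans by blast

lemma continuous_on_apply_at:
  "continuous_on S (\<lambda>x :: 'a::topological_space \<Rightarrow>\<^sub>C 'b::metric_space. apply_bcontfun x t)"
  unfolding continuous_on_iff using dist_fun_lt_imp_dist_val_lt by blast

lemma continuous_on_gauge:
  "continuous_on S (\<lambda>x :: real \<Rightarrow>\<^sub>C (real ^ 'n::finite). gauge (apply_bcontfun x))"
proof -
  have le: "gauge x - gauge y \<le> real CARD('n) * dist x y" for x y :: "real \<Rightarrow>\<^sub>C (real ^ 'n)"
  proof -
    have "gauge x \<le> gauge y + real CARD('n) * dist x y"
    proof (rule gauge_least)
      fix t
      have "l1norm (x t) \<le> l1norm (y t) + l1norm (x t - y t)"
        using l1norm_triangle[of "y t" "x t - y t"] by simp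
      also have "\<dots> \<le> gauge y + real CARD('n) * dist x y"
        using l1norm_le_norm[of "x t - y t"] dist_bounded[of x t y]
        by (intro add_mono gauge_upper) (auto simp: dist_norm intro: order_trans mult_left_mono)
      finally show "l1norm (x t) \<le> gauge y + real CARD('n) * dist x y" .
    qed
    then show ?thesis by simp
  qed
  have "(real CARD('n))-lipschitz_on S (\<lambda>x :: real \<Rightarrow>\<^sub>C (real ^ 'n). gauge x)"
  proof (rule lipschitz_onI)
    fix x y :: "real \<Rightarrow>\<^sub>C (real ^ 'n)"
    show "dist (gauge x) (gauge y) \<le> real CARD('n) * dist x y"
      using le[of x y] le[of y x] by (simp add: dist_real_def dist_commute abs_le_iff)
  qed simp
  then show ?thesis by (rule lipschitz_on_continuous_on)
qed

section \<open>The delay system and its solution operator\<close>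
locale delay_system =
  fixes \<omega> :: real and a b :: "'n::finite \<Rightarrow> real \<Rightarrow> real" and \<tau> :: "real \<Rightarrow> real"
    and f :: "'n \<Rightarrow> real ^ 'n \<Rightarrow> real"
  assumes \<omega>: "0 < \<omega>"
    and cont_a: "continuous_on UNIV (a i)" and a_nonneg: "0 \<le> a i t"
    and per_a: "periodic \<omega> (a i)" and mean_a: "0 < mean \<omega> (a i)"
    and cont_b: "continuous_on UNIV (b i)" and b_nonneg: "0 \<le> b i t"
    and per_b: "periodic \<omega> (b i)" and mean_b: "0 < mean \<omega> (b i)"
    and cont_\<tau>: "continuous_on UNIV \<tau>" and per_\<tau>: "periodic \<omega> \<tau>"
    and cont_f: "continuous_on orthant (f i)"
    and f_nonneg: "u \<in> orthant \<Longrightarrow> 0 \<le> f i u"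
    and f_pos: "\<lbrakk>u \<in> orthant; 0 < l1norm u\<rbrakk> \<Longrightarrow> 0 < f i u"
begin

sublocale decay: periodic_decay \<omega> "a i" for i
  by standard (use \<omega> cont_a a_nonneg per_a mean_a in auto)

abbreviation E :: "'n \<Rightarrow> real" where "E i \<equiv> decay.E i"
abbreviation \<beta> :: "'n \<Rightarrow> real" where "\<beta> i \<equiv> prim (b i) \<omega>"
abbreviation "\<sigma> \<equiv> sigma \<omega> a"
abbreviation "\<Gamma> \<equiv> Gamma_const \<omega> a b"
abbreviation "chi \<equiv> chi_const \<omega> a b"

lemma inverse_sigma_comp: "inverse (sigma_comp \<omega> a i) = E i"
  by (simp add: sigma_comp_def decay.E_eq_mean exp_minus)

lemma \<beta>_eq: "\<beta> i = mean \<omega> (b i) * \<omega>"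
  using \<omega> by (simp add: mean_def prim_eq_integral)

lemma \<beta>_pos: "0 < \<beta> i"
  using mean_b \<omega> by (simp add: \<beta>_eq)

lemma \<sigma>_le: "\<sigma> \<le> inverse (E i)"
  by (simp add: sigma_def flip: inverse_sigma_comp)

lemma \<sigma>_pos: "0 < \<sigma>"
  by (simp add: sigma_def sigma_comp_def)

lemma \<sigma>_lt_1: "\<sigma> < 1"
proof -
  have "inverse (E undefined) < 1" using decay.E_gt_1 by (simp add: inverse_less_1_iff)
  with \<sigma>_le show ?thesis by (rule le_less_trans)
qed

lemma \<Gamma>_pos: "0 < \<Gamma>"
  using \<beta>_pos decay.E_gt_1
  by (simp add: Gamma_const_def inverse_sigma_comp flip: \<beta>_eq)

lemma \<Gamma>_le: "\<Gamma> \<le> \<beta> i / (E i - 1)"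
  by (simp add: Gamma_const_def inverse_sigma_comp \<beta>_eq)

lemma chi_eq: "chi = (\<Sum>i\<in>UNIV. E i / (E i - 1) * \<beta> i)"
  by (simp add: chi_const_def inverse_sigma_comp \<beta>_eq)

lemma chi_pos: "0 < chi"
  unfolding chi_eq using \<beta>_pos decay.E_gt_1
  by (intro sum_pos) (auto intro!: mult_pos_pos divide_pos_pos intro: less_trans[OF zero_less_one])

text \<open>
  The inequality between values at different times is the conclusion of \<open>response_harnack\<close>.
\<close>
definition cone :: "(real \<Rightarrow>\<^sub>C (real ^ 'n)) set" where
  "cone = {x. periodic \<omega> (apply_bcontfun x) \<and> (\<forall>i t. 0 \<le> x t $ i) \<and>
              (\<forall>i s t. inverse (E i) * x s $ i \<le> x t $ i)}"

lemma cone_orthant: "x \<in> cone \<Longrightarrow> x t \<in> orthant"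
  by (simp add: cone_def orthant_def)

text \<open>
  This confines the values of a function of gauge \<open>r\<close> to the shell on which \<open>m(r)\<close> is the
  minimum of \<open>f\<close>.
\<close>
lemma \<sigma>_gauge_le:
  assumes "x \<in> cone"
  shows "\<sigma> * gauge x \<le> l1norm (x t)"
proof -
  have "gauge x \<le> l1norm (x t) / \<sigma>"
  proof (rule gauge_least)
    fix s
    have "\<sigma> * x s $ i \<le> x t $ i" for i
    proof -
      have "\<sigma> * x s $ i \<le> inverse (E i) * x s $ i"
        using assms \<sigma>_le by (intro mult_right_mono) (auto simp: cone_def)
      also have "\<dots> \<le> x t $ i" using assms by (simp add: cone_def)
      finally show ?thesis .
    qed
    then have "\<sigma> * l1norm (x s) \<le> l1norm (x t)"
      using assms by (auto simp: l1norm_def sum_distrib_left cone_def intro!: sum_mono)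
    then show "l1norm (x s) \<le> l1norm (x t) / \<sigma>"
      using \<sigma>_pos by (simp add: pos_le_divide_eq mult.commute)
  qed
  then show ?thesis using \<sigma>_pos by (simp add: pos_le_divide_eq mult.commute)
qed

sublocale gauged_cone cone "\<lambda>x. gauge (apply_bcontfun x)"
proof
  show "convex cone"
  proof (rule convexI)
    fix x y :: "real \<Rightarrow>\<^sub>C (real ^ 'n)" and u v :: real
    assume *: "x \<in> cone" "y \<in> cone" "0 \<le> u" "0 \<le> v"
    have "inverse (E i) * (u * x s $ i + v * y s $ i) \<le> u * x t $ i + v * y t $ i" for i s t
    proof -
      have "u * (inverse (E i) * x s $ i) + v * (inverse (E i) * y s $ i) \<le> u * x t $ i + v * y t $ i"
        using * by (intro add_mono mult_left_mono) (auto simp: cone_def)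
      then show ?thesis by (simp add: algebra_simps)
    qed
    then show "u *\<^sub>R x + v *\<^sub>R y \<in> cone" using * by (auto simp: cone_def periodic_def)
  qed
  show "c *\<^sub>R x \<in> cone" if "x \<in> cone" "0 \<le> c" for x c
  proof -
    have "inverse (E i) * (c * x s $ i) \<le> c * x t $ i" for i s t
    proof -
      have "c * (inverse (E i) * x s $ i) \<le> c * x t $ i"
        using that by (intro mult_left_mono) (auto simp: cone_def)
      then show ?thesis by (simp add: algebra_simps)
    qed
    then show ?thesis using that by (auto simp: cone_def periodic_def)
  qed
  show "x = 0" if "x \<in> cone" "- x \<in> cone" for x
    by (rule bcontfun_eqI) (use that in \<open>auto simp: cone_def vec_eq_iff intro!: antisym\<close>)
  have "inverse (E i) \<le> 1" for i
    using decay.E_gt_1[of i] by (simp add: inverse_le_1_iff)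
  then have "const_bcontfun 1 \<in> cone" by (auto simp: cone_def periodic_def)
  moreover have "const_bcontfun 1 \<noteq> (0 :: real \<Rightarrow>\<^sub>C (real ^ 'n))"
  proof
    assume "const_bcontfun 1 = (0 :: real \<Rightarrow>\<^sub>C (real ^ 'n))"
    from arg_cong[OF this, of "\<lambda>x. apply_bcontfun x 0"] show False by simp
  qed
  ultimately show "\<exists>e\<in>cone. e \<noteq> 0" by blast
  show "continuous_on cone (\<lambda>x. gauge (apply_bcontfun x))" by (rule continuous_on_gauge)
  show "gauge (c *\<^sub>R x) = c * gauge x" if "x \<in> cone" "0 \<le> c" for x c
  proof (rule antisym)
    show "gauge (c *\<^sub>R x) \<le> c * gauge x"
      by (rule gauge_least) (use that in \<open>auto simp: l1norm_scaleR intro!: mult_left_mono gauge_upper\<close>)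
    show "c * gauge x \<le> gauge (c *\<^sub>R x)"
    proof (cases "c = 0")
      case True
      then show ?thesis using gauge_upper[of "0 *\<^sub>R x" 0] l1norm_nonneg[of "apply_bcontfun (0 *\<^sub>R x) 0"] by simp
    next
      case False
      have "gauge x \<le> gauge (c *\<^sub>R x) / c"
      proof (rule gauge_least)
        fix t
        show "l1norm (x t) \<le> gauge (c *\<^sub>R x) / c"
          using gauge_upper[of "c *\<^sub>R x" t] False that
          by (simp add: l1norm_scaleR pos_le_divide_eq mult.commute)
      qed
      then show ?thesis using False that by (simp add: pos_le_divide_eq mult.commute)
    qed
  qed
  show "gauge (x + y) \<le> gauge x + gauge y" for x y :: "real \<Rightarrow>\<^sub>C (real ^ 'n)"
  proof (rule gauge_least)
    fix t
    show "l1norm ((x + y) t) \<le> gauge x + gauge y"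
      using gauge_upper[of x t] gauge_upper[of y t] l1norm_triangle[of "x t" "y t"] by simp
  qed
  show "0 < gauge x" if "x \<in> cone" "x \<noteq> 0" for x
  proof -
    obtain t where "x t \<noteq> 0" using \<open>x \<noteq> 0\<close> by (metis bcontfun_eqI zero_bcontfun.rep_eq)
    then have "0 < l1norm (x t)" using l1norm_eq_0_iff l1norm_nonneg by (metis less_eq_real_def)
    then show ?thesis using gauge_upper[of x t] by linarith
  qed
qed

end

context delay_system
begin

definition forcing :: "real \<Rightarrow> (real \<Rightarrow> real ^ 'n) \<Rightarrow> 'n \<Rightarrow> real \<Rightarrow> real" where
  "forcing lam x i s = lam * b i s * f i (x (s - \<tau> s))"

text \<open>
  The right-hand side is a bounded continuous function only for suitable \<open>x\<close>; all facts about \<open>T\<close>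
  concern \<open>x\<close> in the cone, where \<open>T_apply\<close> removes \<open>Bcontfun\<close>.
\<close>
definition T :: "real \<Rightarrow> (real \<Rightarrow>\<^sub>C (real ^ 'n)) \<Rightarrow> (real \<Rightarrow>\<^sub>C (real ^ 'n))" where
  "T lam x = Bcontfun (\<lambda>t. \<chi> i. decay.response i (forcing lam x i) t)"

lemma f_bounded: "\<exists>M. \<forall>i. \<forall>u\<in>orthant. l1norm u \<le> R \<longrightarrow> f i u \<le> M"
proof -
  have "\<exists>M. \<forall>u\<in>orthant. l1norm u \<le> R \<longrightarrow> f i u \<le> M" for i
  proof -
    have "compact (f i ` {u \<in> orthant. l1norm u \<le> R})"
      by (intro compact_continuous_image compact_orthant_ball continuous_on_subset[OF cont_f]) auto
    then have "bdd_above (f i ` {u \<in> orthant. l1norm u \<le> R})"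
      by (intro bounded_imp_bdd_above compact_imp_bounded)
    then show ?thesis by (auto simp: bdd_above_def)
  qed
  then obtain M where M: "\<And>i u. u \<in> orthant \<Longrightarrow> l1norm u \<le> R \<Longrightarrow> f i u \<le> M i" by metis
  have "f i u \<le> Max (range M)" if "u \<in> orthant" "l1norm u \<le> R" for i u
    using M[OF that, of i] Max_ge[of "range M" "M i"] by (simp add: order_trans)
  then show ?thesis by blast
qed

context
  fixes lam :: real
  assumes lam: "0 < lam"
begin

lemma continuous_forcing:
  assumes "continuous_on UNIV x" "\<And>t. x t \<in> orthant"
  shows "continuous_on UNIV (forcing lam x i)"
proof -
  have "continuous_on UNIV (\<lambda>s. x (s - \<tau> s))"
    by (rule continuous_on_compose2[OF assms(1)]) (auto intro!: continuous_intros cont_\<tau>)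
  then have "continuous_on UNIV (\<lambda>s. f i (x (s - \<tau> s)))"
    by (rule continuous_on_compose2[OF cont_f]) (use assms in auto)
  then show ?thesis unfolding forcing_def by (intro continuous_intros cont_b)
qed

lemma periodic_forcing:
  assumes "periodic \<omega> x"
  shows "periodic \<omega> (forcing lam x i)"
  unfolding periodic_def
proof
  fix t
  have "x (t + \<omega> - \<tau> (t + \<omega>)) = x ((t - \<tau> t) + \<omega>)"
    using per_\<tau> by (simp add: periodic_def diff_add_eq)
  also have "\<dots> = x (t - \<tau> t)" using assms unfolding periodic_def by blast
  finally show "forcing lam x i (t + \<omega>) = forcing lam x i t"
    using per_b by (simp add: forcing_def periodic_def)
qed

lemma forcing_nonneg:
  assumes "\<And>t. x t \<in> orthant"
  shows "0 \<le> forcing lam x i t"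
  using lam b_nonneg f_nonneg assms by (simp add: forcing_def)

lemma forcing_cone:
  assumes "x \<in> cone"
  shows "continuous_on UNIV (forcing lam x i)" "periodic \<omega> (forcing lam x i)"
    "0 \<le> forcing lam x i t"
  using assms
  by (auto simp: cone_def intro!: continuous_forcing periodic_forcing forcing_nonneg cone_orthant[OF assms])

lemma response_b:
  assumes "0 \<le> m"
  shows "m * (\<beta> i / (E i - 1)) \<le> decay.response i (\<lambda>t. m * b i t) t"
    and "decay.response i (\<lambda>t. m * b i t) t \<le> m * (E i / (E i - 1) * \<beta> i)"
  using decay.response_bounds[of "\<lambda>t. m * b i t" i t] assms b_nonneg cont_b[of i] per_b[of i]
  by (auto simp: prim_const_mult continuous_on_mult_left periodic_def mult.left_commute)

lemma forcing_upper:
  assumes x: "x \<in> cone" and M: "\<And>t. f i (x t) \<le> M"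
  shows "forcing lam x i t \<le> (lam * M) * b i t"
proof -
  have "lam * b i t * f i (x (t - \<tau> t)) \<le> lam * b i t * M"
    using lam b_nonneg M by (intro mult_left_mono) auto
  then show ?thesis by (simp add: forcing_def mult_ac)
qed

lemma response_forcing_upper:
  assumes x: "x \<in> cone" and M: "\<And>t. f i (x t) \<le> M"
  shows "decay.response i (forcing lam x i) t \<le> lam * M * (E i / (E i - 1) * \<beta> i)"
proof -
  have "0 \<le> f i (x 0)" using f_nonneg cone_orthant[OF x] by blast
  then have M0: "0 \<le> lam * M" using M[of 0] lam by simp
  have "decay.response i (forcing lam x i) t \<le> decay.response i (\<lambda>t. (lam * M) * b i t) t"
    using forcing_cone[OF x] forcing_upper[OF assms] per_b[of i]
    by (intro decay.response_mono) (auto intro!: continuous_on_mult_left cont_b simp: periodic_def)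
  then show ?thesis using response_b(2)[OF M0] order_trans by blast
qed

lemma response_forcing_lower:
  assumes x: "x \<in> cone" and m: "\<And>t. m \<le> f i (x t)" "0 \<le> m"
  shows "lam * m * \<Gamma> \<le> decay.response i (forcing lam x i) t"
proof -
  have le: "(lam * m) * b i s \<le> forcing lam x i s" for s
  proof -
    have "lam * b i s * m \<le> lam * b i s * f i (x (s - \<tau> s))"
      using lam b_nonneg m by (intro mult_left_mono) auto
    then show ?thesis by (simp add: forcing_def mult_ac)
  qed
  have m0: "0 \<le> lam * m" using m lam by simp
  have "lam * m * \<Gamma> \<le> lam * m * (\<beta> i / (E i - 1))"
    using m0 \<Gamma>_le by (rule mult_left_mono[rotated])
  also have "\<dots> \<le> decay.response i (\<lambda>t. (lam * m) * b i t) t" by (rule response_b(1)[OF m0])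
  also have "\<dots> \<le> decay.response i (forcing lam x i) t"
    using forcing_cone[OF x] le per_b[of i]
    by (intro decay.response_mono) (auto intro!: continuous_on_mult_left cont_b simp: periodic_def)
  finally show ?thesis .
qed

lemma T_apply:
  assumes x: "x \<in> cone"
  shows "T lam x t = (\<chi> i. decay.response i (forcing lam x i) t)"
proof -
  from f_bounded[of "gauge x"] obtain M
    where "\<forall>i. \<forall>u\<in>orthant. l1norm u \<le> gauge x \<longrightarrow> f i u \<le> M" ..
  then have M: "f i (x t) \<le> M" for i t using cone_orthant[OF x] gauge_upper by blast
  let ?y = "\<lambda>t. \<chi> i. decay.response i (forcing lam x i) t"
  have "?y \<in> bcontfun"
  proof (rule bcontfun_normI)
    have "continuous_on UNIV (decay.response i (forcing lam x i))" for i
      by (rule DERIV_continuous_on[OF has_field_derivative_at_within[OF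
            decay.response_derivative[OF forcing_cone(1,2)[OF x]]]])
    then show "continuous_on UNIV ?y" by (intro continuous_on_vec_lambda)
    show "norm (?y t) \<le> (\<Sum>i\<in>UNIV. lam * M * (E i / (E i - 1) * \<beta> i))" for t
    proof -
      have "norm (?y t) \<le> (\<Sum>i\<in>UNIV. \<bar>decay.response i (forcing lam x i) t\<bar>)"
        using norm_le_l1norm[of "?y t"] by (simp add: l1norm_def)
      also have "\<dots> \<le> (\<Sum>i\<in>UNIV. lam * M * (E i / (E i - 1) * \<beta> i))"
        using response_forcing_upper[OF x M]
          decay.response_nonneg[OF forcing_cone[OF x]]
        by (intro sum_mono) auto
      finally show ?thesis .
    qed
  qed
  then show ?thesis by (simp add: T_def Bcontfun_inverse)
qed

lemma T_component: "x \<in> cone \<Longrightarrow> T lam x t $ i = decay.response i (forcing lam x i) t"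
  by (simp add: T_apply)

lemma T_cone:
  assumes x: "x \<in> cone"
  shows "T lam x \<in> cone"
  using decay.response_nonneg[OF forcing_cone[OF x]] decay.response_harnack[OF forcing_cone[OF x]]
    decay.response_periodic[OF forcing_cone(1,2)[OF x]]
  by (auto simp: cone_def T_apply[OF x] periodic_def vec_eq_iff)

lemma l1norm_T_le:
  assumes x: "x \<in> cone" and M: "\<And>i t. f i (x t) \<le> M"
  shows "l1norm (T lam x t) \<le> lam * M * chi"
proof -
  have "l1norm (T lam x t) = (\<Sum>i\<in>UNIV. decay.response i (forcing lam x i) t)"
    using decay.response_nonneg[OF forcing_cone[OF x]] by (simp add: l1norm_def T_apply[OF x])
  also have "\<dots> \<le> (\<Sum>i\<in>UNIV. lam * M * (E i / (E i - 1) * \<beta> i))"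
    by (intro sum_mono response_forcing_upper x M)
  also have "\<dots> = lam * M * chi" by (simp add: chi_eq sum_distrib_left)
  finally show ?thesis .
qed

lemma gauge_T_le:
  assumes "x \<in> cone" "\<And>i t. f i (x t) \<le> M"
  shows "gauge (T lam x) \<le> lam * M * chi"
  using l1norm_T_le[OF assms] by (rule gauge_least)

lemma gauge_T_ge:
  assumes x: "x \<in> cone" and m: "\<And>t. m \<le> f i (x t)" "0 \<le> m"
  shows "lam * m * \<Gamma> \<le> gauge (T lam x)"
proof -
  have "lam * m * \<Gamma> \<le> \<bar>T lam x 0 $ i\<bar>"
    using response_forcing_lower[OF x m] T_component[OF x] by (metis abs_ge_self order_trans)
  also have "\<dots> \<le> gauge (T lam x)"
    using component_le_l1norm gauge_upper order_trans by blast
  finally show ?thesis .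
qed

text \<open>
  On functions of bounded gauge only the values of \<open>f\<close> on a compact set matter, and there
  \<open>f\<close> is uniformly continuous. A change of all \<open>f\<^sup>i\<close> by at most \<open>\<eta>\<close> changes the response by at most
  \<open>\<lambda> \<eta> \<chi>\<close>.
\<close>
lemma continuous_T: "continuous_on {x \<in> cone. gauge x \<le> R} (T lam)"
proof (rule continuous_onI)
  fix x and e :: real
  assume x: "x \<in> {x \<in> cone. gauge x \<le> R}" and "0 < e"
  define \<eta> where "\<eta> = e / (lam * chi)"
  have \<eta>: "0 < \<eta>" using \<open>0 < e\<close> lam chi_pos by (simp add: \<eta>_def)
  let ?B = "{u \<in> orthant. l1norm u \<le> R}"
  have unif: "uniformly_continuous_on ?B (f i)" for i
    by (intro compact_uniformly_continuous compact_orthant_ball continuous_on_subset[OF cont_f]) auto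
  have "\<forall>i. \<exists>d>0. \<forall>u\<in>?B. \<forall>v\<in>?B. dist v u < d \<longrightarrow> dist (f i v) (f i u) < \<eta>"
    using \<eta> unif unfolding uniformly_continuous_on_def by auto
  from choice[OF this] obtain d
    where d': "\<forall>i. 0 < d i \<and> (\<forall>u\<in>?B. \<forall>v\<in>?B. dist v u < d i \<longrightarrow> dist (f i v) (f i u) < \<eta>)" ..
  then have d: "0 < d i" for i by blast
  have fd: "dist (f i v) (f i u) < \<eta>" if "u \<in> ?B" "v \<in> ?B" "dist v u < d i" for i u v
    using d' that by blast
  define \<delta> where "\<delta> = Min (range d)"
  have \<delta>: "0 < \<delta>" "\<delta> \<le> d i" for i using d by (auto simp: \<delta>_def)
  have "dist (T lam y) (T lam x) \<le> e" if y: "y \<in> {x \<in> cone. gauge x \<le> R}" and "dist y x < \<delta>" for y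
  proof (rule dist_bound)
    fix t
    have mem: "x s \<in> ?B" "y s \<in> ?B" for s
      using x y cone_orthant[of x s] cone_orthant[of y s] gauge_upper[of x s] gauge_upper[of y s] by auto
    have diff: "\<bar>forcing lam y i s - forcing lam x i s\<bar> \<le> (lam * \<eta>) * b i s" for i s
    proof -
      have "\<bar>f i (y (s - \<tau> s)) - f i (x (s - \<tau> s))\<bar> \<le> \<eta>"
        using fd[OF mem, of "s - \<tau> s" "s - \<tau> s" i] dist_bounded[of y "s - \<tau> s" x] \<open>dist y x < \<delta>\<close> \<delta>(2)[of i]
        by (simp add: dist_real_def)
      then have "lam * b i s * \<bar>f i (y (s - \<tau> s)) - f i (x (s - \<tau> s))\<bar> \<le> lam * b i s * \<eta>"
        using lam b_nonneg by (intro mult_left_mono) auto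
      moreover have "\<bar>forcing lam y i s - forcing lam x i s\<bar> = lam * b i s * \<bar>f i (y (s - \<tau> s)) - f i (x (s - \<tau> s))\<bar>"
        using lam b_nonneg[of i s] by (simp add: forcing_def abs_mult flip: right_diff_distrib)
      ultimately show ?thesis by (simp add: mult_ac)
    qed
    have "\<bar>decay.response i (forcing lam y i) t - decay.response i (forcing lam x i) t\<bar>
        \<le> lam * \<eta> * (E i / (E i - 1) * \<beta> i)" for i
    proof -
      have "\<bar>decay.response i (forcing lam y i) t - decay.response i (forcing lam x i) t\<bar>
        \<le> decay.response i (\<lambda>s. (lam * \<eta>) * b i s) t"
        using x y forcing_cone diff per_b[of i]
        by (intro decay.response_abs_diff_le) (auto intro!: continuous_on_mult_left cont_b simp: periodic_def)
      also have "\<dots> \<le> lam * \<eta> * (E i / (E i - 1) * \<beta> i)"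
        using lam \<eta> by (intro response_b) auto
      finally show ?thesis .
    qed
    then have "l1norm (T lam y t - T lam x t) \<le> (\<Sum>i\<in>UNIV. lam * \<eta> * (E i / (E i - 1) * \<beta> i))"
      using x y by (auto simp: l1norm_def T_component intro!: sum_mono)
    also have "\<dots> = lam * \<eta> * chi" by (simp add: chi_eq sum_distrib_left)
    also have "\<dots> = e" using lam chi_pos by (simp add: \<eta>_def)
    finally show "dist (T lam y t) (T lam x t) \<le> e"
      using norm_le_l1norm order_trans by (auto simp: dist_norm)
  qed
  with \<delta>(1) show "\<exists>d>0. \<forall>y\<in>{x \<in> cone. gauge x \<le> R}. dist y x < d \<longrightarrow> dist (T lam y) (T lam x) \<le> e"
    by blast
qed

end

definition equilipschitz :: "real \<Rightarrow> real \<Rightarrow> (real \<Rightarrow>\<^sub>C (real ^ 'n)) set" where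
  "equilipschitz B L = {x \<in> cone. (\<forall>t. l1norm (x t) \<le> B) \<and> (\<forall>s t. norm (x s - x t) \<le> L * \<bar>s - t\<bar>)}"

lemma closed_equilipschitz: "closed (equilipschitz B L)"
  unfolding equilipschitz_def cone_def periodic_def mem_Collect_eq
  by (intro closed_Collect_conj closed_Collect_all closed_Collect_le closed_Collect_eq
      continuous_intros continuous_on_apply_at)

text \<open>
  Arzela--Ascoli gives uniform convergence of a subsequence on one period, and periodicity
  extends it to the line.
\<close>
lemma compact_equilipschitz: "compact (equilipschitz B L)"
  unfolding compact_def
proof (intro allI impI)
  fix X :: "nat \<Rightarrow> real \<Rightarrow>\<^sub>C (real ^ 'n)"
  assume X: "\<forall>n. X n \<in> equilipschitz B L"
  then have Xn: "l1norm (X n t) \<le> B" "norm (X n s - X n t) \<le> L * \<bar>s - t\<bar>"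
    "periodic \<omega> (apply_bcontfun (X n))" for n s t
    by (auto simp: equilipschitz_def cone_def)
  obtain g and k :: "nat \<Rightarrow> nat" where k: "strict_mono k"
    and lim: "\<And>e. 0 < e \<Longrightarrow> \<exists>N. \<forall>n x. n \<ge> N \<and> x \<in> {0..\<omega>} \<longrightarrow> norm (X (k n) x - g x) < e"
  proof (rule Arzela_Ascoli[of "{0..\<omega>}" "\<lambda>n. apply_bcontfun (X n)" B])
    show "norm (X n t) \<le> B" for n t using Xn(1) norm_le_l1norm order_trans by blast
    show "\<exists>d>0. \<forall>n y. y \<in> {0..\<omega>} \<and> norm (s - y) < d \<longrightarrow> norm (X n s - X n y) < e"
      if "0 < e" for s e
    proof (intro exI conjI allI impI)
      show "0 < e / (\<bar>L\<bar> + 1)" using \<open>0 < e\<close> by simp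
      fix n y assume "y \<in> {0..\<omega>} \<and> norm (s - y) < e / (\<bar>L\<bar> + 1)"
      then have "(\<bar>L\<bar> + 1) * \<bar>s - y\<bar> < e" by (simp add: pos_less_divide_eq mult.commute)
      moreover have "L * \<bar>s - y\<bar> \<le> (\<bar>L\<bar> + 1) * \<bar>s - y\<bar>" by (intro mult_right_mono) auto
      ultimately show "norm (X n s - X n y) < e" using Xn(2)[of n s y] by linarith
    qed
  qed auto
  have "uniform_limit UNIV (\<lambda>n. apply_bcontfun (X (k n))) (\<lambda>t. g (wrap \<omega> t)) sequentially"
  proof (rule uniform_limitI)
    fix e :: real assume "0 < e"
    then obtain N where N: "\<And>n t. \<lbrakk>n \<ge> N; t \<in> {0..\<omega>}\<rbrakk> \<Longrightarrow> norm (X (k n) t - g t) < e"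
      using lim by blast
    have "dist (X (k n) t) (g (wrap \<omega> t)) < e" if "n \<ge> N" for n t
      using N[OF that wrap_in_period[OF \<omega>, of t]] periodic_wrap[OF Xn(3), of "k n" t] by (simp add: dist_norm)
    then show "\<forall>\<^sub>F n in sequentially. \<forall>t\<in>UNIV. dist (X (k n) t) (g (wrap \<omega> t)) < e"
      using eventually_sequentially by blast
  qed
  then obtain l where l: "(\<lambda>n. X (k n)) \<longlonglongrightarrow> l"
    using uniform_limit_bcontfunE[of "\<lambda>n. X (k n)"] by (metis sequentially_bot)
  moreover have "l \<in> equilipschitz B L"
    by (rule closed_sequentially[OF closed_equilipschitz _ l]) (use X in simp)
  ultimately show "\<exists>l\<in>equilipschitz B L. \<exists>r. strict_mono r \<and> (X \<circ> r) \<longlonglongrightarrow> l"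
    using k by (auto simp: o_def)
qed

text \<open>
  A bound of \<open>f\<close> bounds the forcing and the response, and then the differential equation bounds the
  derivative of the response. Together with \<open>compact_equilipschitz\<close> this is the compactness of \<open>T\<close>.
\<close>
lemma T_equilipschitz:
  assumes "0 < lam"
  obtains B L where "\<And>x. \<lbrakk>x \<in> cone; gauge x \<le> R\<rbrakk> \<Longrightarrow> T lam x \<in> equilipschitz B L"
proof -
  from f_bounded[of R] obtain M' where M': "\<forall>i. \<forall>u\<in>orthant. l1norm u \<le> R \<longrightarrow> f i u \<le> M'" ..
  define M where "M = max 0 M'"
  have M: "f i u \<le> M" if "u \<in> orthant" "l1norm u \<le> R" for i u
    using M' that by (auto simp: M_def le_max_iff_disj)
  have "\<exists>A. \<forall>t. \<bar>a i t\<bar> \<le> A" for i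
    using continuous_periodic_bounded[OF cont_a per_a \<omega>] by simp
  then obtain A where A: "\<And>i t. \<bar>a i t\<bar> \<le> A i" by metis
  have "\<exists>A. \<forall>t. \<bar>b i t\<bar> \<le> A" for i
    using continuous_periodic_bounded[OF cont_b per_b \<omega>] by simp
  then obtain A' where A': "\<And>i t. \<bar>b i t\<bar> \<le> A' i" by metis
  define B where "B = lam * M * chi"
  define L where "L i = A i * B + lam * M * A' i" for i
  have "T lam x \<in> equilipschitz B (\<Sum>i\<in>UNIV. L i)" if x: "x \<in> cone" "gauge x \<le> R" for x
  proof -
    have fM: "f i (x t) \<le> M" for i t
      using M[OF cone_orthant[OF x(1)]] x(2) gauge_le_iff by blast
    have TB: "l1norm (T lam x t) \<le> B" for t
      unfolding B_def using l1norm_T_le[OF assms x(1) fM] .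
    have lip: "\<bar>T lam x s $ i - T lam x t $ i\<bar> \<le> L i * \<bar>s - t\<bar>" for i s t
    proof -
      let ?y = "decay.response i (forcing lam x i)"
      have "norm (?y s - ?y t) \<le> L i * norm (s - t)"
      proof (rule field_differentiable_bound[of UNIV])
        fix u
        show "(?y has_field_derivative - a i u * ?y u + forcing lam x i u) (at u within UNIV)"
          using decay.response_derivative[OF forcing_cone(1,2)[OF assms x(1)]] by simp
        have y: "0 \<le> ?y u" "?y u \<le> B"
          using decay.response_nonneg[OF forcing_cone[OF assms x(1)]]
            component_le_l1norm[of "T lam x u" i] TB[of u] T_component[OF assms x(1), of u i] by auto
        have "\<bar>a i u * ?y u\<bar> \<le> A i * B"
          unfolding abs_mult using A[of i u] y by (intro mult_mono) auto
        moreover have "\<bar>forcing lam x i u\<bar> \<le> lam * M * A' i"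
        proof -
          have "\<bar>forcing lam x i u\<bar> \<le> lam * M * b i u"
            using forcing_cone(3)[OF assms x(1), of i u] forcing_upper[OF assms x(1), of i M u] fM by simp
          also have "\<dots> \<le> lam * M * A' i"
            using A'[of i u] assms by (intro mult_left_mono) (auto simp: M_def)
          finally show ?thesis .
        qed
        ultimately show "norm (- a i u * ?y u + forcing lam x i u) \<le> L i"
          by (simp add: L_def)
      qed auto
      then show ?thesis by (simp add: T_component[OF assms x(1)])
    qed
    have "norm (T lam x s - T lam x t) \<le> (\<Sum>i\<in>UNIV. L i) * \<bar>s - t\<bar>" for s t
    proof -
      have "norm (T lam x s - T lam x t) \<le> l1norm (T lam x s - T lam x t)" by (rule norm_le_l1norm)
      also have "\<dots> \<le> (\<Sum>i\<in>UNIV. L i * \<bar>s - t\<bar>)"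
        unfolding l1norm_def by (intro sum_mono) (use lip in simp)
      finally show ?thesis by (simp add: sum_distrib_right)
    qed
    with TB T_cone[OF assms x(1)] show ?thesis by (simp add: equilipschitz_def)
  qed
  then show thesis by (rule that)
qed

lemma fixed_point_is_solution:
  assumes "0 < lam" and x: "x \<in> cone" "T lam x = x" "0 < gauge x"
  shows "apply_bcontfun x \<in> positive_periodic_solutions \<omega> a b \<tau> f lam"
proof -
  have xi: "x t $ i = decay.response i (forcing lam x i) t" for t i
    using T_component[OF assms(1) x(1)] x(2) by simp
  have "is_solution a b \<tau> f lam x"
    unfolding is_solution_def
  proof (intro allI)
    fix i t
    have "(\<lambda>s. x s $ i) = decay.response i (forcing lam x i)"
      using xi by (simp add: fun_eq_iff)
    then have "((\<lambda>s. x s $ i) has_real_derivative - a i t * x t $ i + forcing lam x i t) (at t)"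
      using decay.response_derivative[OF forcing_cone(1,2)[OF assms(1) x(1)]] xi[of t i] by metis
    then show "((\<lambda>s. x s $ i) has_real_derivative - a i t * x t $ i + lam * b i t * f i (x (t - \<tau> t))) (at t)"
      by (simp add: forcing_def)
  qed
  moreover have "positive x"
  proof -
    have "\<exists>t. x t \<noteq> 0"
    proof (rule ccontr)
      assume "\<not> (\<exists>t. x t \<noteq> 0)"
      then have "gauge x \<le> 0" by (intro gauge_least) (simp add: l1norm_def)
      with x(3) show False by simp
    qed
    then obtain s i where "x s $ i \<noteq> 0" by (auto simp: vec_eq_iff)
    moreover have "0 \<le> x s $ i" using x(1) by (simp add: cone_def)
    ultimately have "0 < x s $ i" by simp
    then have "0 < inverse (E i) * x s $ i" using decay.E_gt_1[of i] by simp
    then have "0 < x t $ i" for t using x(1) by (auto simp: cone_def intro: less_le_trans)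
    then show ?thesis using x(1) by (auto simp: positive_def cone_def)
  qed
  ultimately show ?thesis using x(1) by (simp add: positive_periodic_solutions_def cone_def)
qed

text \<open>
  By uniqueness of the response, every positive periodic solution is of the form \<open>T x\<close> and hence
  lies in the cone, so the estimates for \<open>T\<close> apply to it.
\<close>
lemma solution_is_fixed_point:
  assumes "0 < lam" and y: "y \<in> positive_periodic_solutions \<omega> a b \<tau> f lam"
  obtains x where "apply_bcontfun x = y" "x \<in> cone" "T lam x = x" "0 < gauge x"
proof -
  have sol: "((\<lambda>s. y s $ i) has_real_derivative - a i t * y t $ i + forcing lam y i t) (at t)" for i t
    using y by (simp add: positive_periodic_solutions_def is_solution_def forcing_def)
  have pos: "positive y" and per: "periodic \<omega> y"
    using y by (auto simp: positive_periodic_solutions_def)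
  have orth: "y t \<in> orthant" for t using pos by (simp add: positive_def orthant_def)
  have "continuous_on UNIV (\<lambda>t. y t $ i)" for i
    by (rule DERIV_continuous_on[OF has_field_derivative_at_within[OF sol]])
  then have "continuous_on UNIV (\<lambda>t. \<chi> i. y t $ i)" by (intro continuous_on_vec_lambda)
  then have cont: "continuous_on UNIV y" by simp
  have force: "continuous_on UNIV (forcing lam y i)" "periodic \<omega> (forcing lam y i)"
    "0 \<le> forcing lam y i t" for i t
    using continuous_forcing[OF assms(1) cont orth] periodic_forcing[OF assms(1) per]
      forcing_nonneg[OF assms(1) orth] by auto
  have yi: "(\<lambda>t. y t $ i) = decay.response i (forcing lam y i)" for i
    by (rule decay.response_unique[OF force(1) sol]) (use per in \<open>simp add: periodic_def\<close>)
  have "y \<in> bcontfun"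
    using continuous_periodic_bounded[OF cont per \<omega>] bcontfun_normI[OF cont] by blast
  then obtain x where x: "apply_bcontfun x = y" by (metis Bcontfun_inverse)
  have xc: "x \<in> cone"
    using per pos decay.response_harnack[OF force] yi
    by (auto simp: cone_def x positive_def fun_eq_iff)
  have "T lam x = x"
    by (rule bcontfun_eqI) (use yi in \<open>auto simp: T_apply[OF assms(1) xc] x vec_eq_iff fun_eq_iff\<close>)
  moreover have "0 < gauge x"
  proof -
    obtain i where "0 < y 0 $ i" using pos by (auto simp: positive_def)
    then show ?thesis using component_le_l1norm[of "y 0" i] gauge_upper[of x 0] x by simp
  qed
  ultimately show thesis using that x xc by blast
qed

end

context delay_system
begin

section \<open>Solutions between two radii\<close>

text \<open>
  Conditions on \<open>f\<close> at the radius \<open>r\<close>, independent of any function \<open>x\<close>; \<open>grows_T\<close> and \<open>shrinks_T\<close>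
  draw the consequences for \<open>T\<close>. The component \<open>i\<close> and the bounds \<open>m\<close>, \<open>M\<close> may depend on \<open>r\<close>.
\<close>
definition grows :: "real \<Rightarrow> real \<Rightarrow> bool" where
  "grows lam r \<longleftrightarrow> (\<exists>i m. 0 \<le> m \<and> r < lam * m * \<Gamma> \<and>
     (\<forall>u\<in>orthant. \<sigma> * r \<le> l1norm u \<longrightarrow> l1norm u \<le> r \<longrightarrow> m \<le> f i u))"

definition shrinks :: "real \<Rightarrow> real \<Rightarrow> bool" where
  "shrinks lam r \<longleftrightarrow> (\<exists>M. lam * M * chi < r \<and> (\<forall>i. \<forall>u\<in>orthant. l1norm u \<le> r \<longrightarrow> f i u \<le> M))"

lemma grows_T:
  fixes x :: "real \<Rightarrow>\<^sub>C (real ^ 'n)"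
  assumes "0 < lam" "grows lam (gauge x)" "x \<in> cone"
  shows "gauge x < gauge (T lam x)"
proof -
  obtain i m where m: "0 \<le> m" "gauge x < lam * m * \<Gamma>"
    "\<forall>u\<in>orthant. \<sigma> * gauge x \<le> l1norm u \<longrightarrow> l1norm u \<le> gauge x \<longrightarrow> m \<le> f i u"
    using assms(2) unfolding grows_def by auto
  have "m \<le> f i (x t)" for t
    using m(3) cone_orthant[OF assms(3)] \<sigma>_gauge_le[OF assms(3)] gauge_upper[of x t] by blast
  from gauge_T_ge[OF assms(1,3) this m(1)] m(2) show ?thesis by linarith
qed

lemma shrinks_T:
  fixes x :: "real \<Rightarrow>\<^sub>C (real ^ 'n)"
  assumes "0 < lam" "shrinks lam (gauge x)" "x \<in> cone"
  shows "gauge (T lam x) < gauge x"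
proof -
  obtain M where M: "lam * M * chi < gauge x" "\<forall>i. \<forall>u\<in>orthant. l1norm u \<le> gauge x \<longrightarrow> f i u \<le> M"
    using assms(2) unfolding shrinks_def by auto
  have "f i (x t) \<le> M" for i t
    using M(2) cone_orthant[OF assms(3)] gauge_upper[of x t] by blast
  from gauge_T_le[OF assms(1,3) this] M(1) show ?thesis by linarith
qed

text \<open>
  By positivity of \<open>f\<close> away from \<open>0\<close> and compactness of the shell.
\<close>
lemma f_lower_shell:
  assumes "0 < c"
  shows "\<exists>m>0. \<forall>u\<in>orthant. c \<le> l1norm u \<longrightarrow> l1norm u \<le> R \<longrightarrow> m \<le> f i u"
proof (cases "{u \<in> orthant. c \<le> l1norm u \<and> l1norm u \<le> R} = ({} :: (real ^ 'n) set)")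
  case True
  then show ?thesis by (intro exI[of _ 1]) auto
next
  case False
  obtain v where v: "v \<in> orthant" "c \<le> l1norm v"
    and min: "\<And>u. \<lbrakk>u \<in> orthant; c \<le> l1norm u; l1norm u \<le> R\<rbrakk> \<Longrightarrow> f i v \<le> f i u"
    using continuous_attains_inf[OF compact_orthant_shell False continuous_on_subset[OF cont_f[of i]]]
    by auto
  then show ?thesis using f_pos[of v i] assms by (intro exI[of _ "f i v"]) auto
qed

text \<open>
  The inequalities for \<open>T\<close> at the two radii are strict, so no fixed point has gauge exactly \<open>r\<close> or
  \<open>R\<close>.
\<close>
proposition solution_between:
  assumes lam: "0 < lam" and r: "0 < r" "r < R"
    and "grows lam r \<and> shrinks lam R \<or> shrinks lam r \<and> grows lam R"
  shows "\<exists>y\<in>positive_periodic_solutions \<omega> a b \<tau> f lam. r < gauge y \<and> gauge y < R"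
proof -
  obtain B L where D: "\<And>x. \<lbrakk>x \<in> cone; gauge x \<le> R\<rbrakk> \<Longrightarrow> T lam x \<in> equilipschitz B L"
    using T_equilipschitz[OF lam] by blast
  have sub: "equilipschitz B L \<subseteq> cone" by (auto simp: equilipschitz_def)
  have cont: "continuous_on {x \<in> cone. r \<le> gauge x \<and> gauge x \<le> R} (T lam)"
    by (rule continuous_on_subset[OF continuous_T[OF lam, of R]]) auto
  have "\<exists>x :: real \<Rightarrow>\<^sub>C (real ^ 'n). x \<in> cone \<and> r \<le> gauge x \<and> gauge x \<le> R \<and> T lam x = x"
    using assms(4)
  proof (elim disjE conjE)
    assume *: "grows lam r" "shrinks lam R"
    obtain x where "x \<in> cone" "r \<le> gauge x" "gauge x \<le> R" "T lam x = x"
    proof (rule krasnoselskii_compression[OF r(1) less_imp_le[OF r(2)] sub compact_equilipschitz cont])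
      show "T lam x \<in> equilipschitz B L" if "x \<in> cone" "gauge x \<le> R" for x
        using D that .
      show "r \<le> gauge (T lam x)" if "x \<in> cone" "gauge x = r" for x
        using grows_T[OF lam, of x] * that by simp
      show "gauge (T lam x) \<le> R" if "x \<in> cone" "gauge x = R" for x
        using shrinks_T[OF lam, of x] * that by simp
    qed
    then show ?thesis by blast
  next
    assume *: "shrinks lam r" "grows lam R"
    obtain m where m: "0 < m"
      "\<forall>u\<in>orthant. \<sigma> * r \<le> l1norm u \<longrightarrow> l1norm u \<le> R \<longrightarrow> m \<le> f undefined u"
      using f_lower_shell[of "\<sigma> * r" R undefined] \<sigma>_pos r by auto
    have bound: "lam * m * \<Gamma> \<le> gauge (T lam x)" if "x \<in> cone" "r \<le> gauge x" "gauge x \<le> R"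
      for x :: "real \<Rightarrow>\<^sub>C (real ^ 'n)"
    proof (rule gauge_T_ge[OF lam that(1)])
      fix t
      have "\<sigma> * r \<le> \<sigma> * gauge x" using \<sigma>_pos that by simp
      then have "\<sigma> * r \<le> l1norm (x t)" using \<sigma>_gauge_le[OF that(1), of t] by linarith
      moreover have "l1norm (x t) \<le> R" using gauge_upper[of x t] that(3) by linarith
      ultimately show "m \<le> f undefined (x t)" using m(2) cone_orthant[OF that(1)] by blast
    qed (use m in simp)
    have pos: "0 < lam * m * \<Gamma>" using lam m \<Gamma>_pos by simp
    obtain x where "x \<in> cone" "r \<le> gauge x" "gauge x \<le> R" "T lam x = x"
    proof (rule krasnoselskii_expansion[OF r(1) less_imp_le[OF r(2)] sub compact_equilipschitz cont _ pos bound])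
      show "T lam x \<in> equilipschitz B L" if "x \<in> cone" "gauge x \<le> R" for x
        using D that .
      show "gauge (T lam x) \<le> r" if "x \<in> cone" "gauge x = r" for x
        using shrinks_T[OF lam, of x] * that by simp
      show "R \<le> gauge (T lam x)" if "x \<in> cone" "gauge x = R" for x
        using grows_T[OF lam, of x] * that by simp
    qed
    then show ?thesis by blast
  qed
  then obtain x :: "real \<Rightarrow>\<^sub>C (real ^ 'n)"
    where x: "x \<in> cone" "r \<le> gauge x" "gauge x \<le> R" "T lam x = x" by blast
  have "gauge x \<noteq> r" "gauge x \<noteq> R"
    using grows_T[OF lam _ x(1)] shrinks_T[OF lam _ x(1)] x(4) assms(4) by auto
  then have "r < gauge x" "gauge x < R" using x by auto
  moreover from this have "apply_bcontfun x \<in> positive_periodic_solutions \<omega> a b \<tau> f lam"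
    using fixed_point_is_solution[OF lam x(1,4)] r by simp
  ultimately show ?thesis by blast
qed

lemma no_solution:
  assumes "0 < lam" "(\<forall>r>0. grows lam r) \<or> (\<forall>r>0. shrinks lam r)"
  shows "positive_periodic_solutions \<omega> a b \<tau> f lam = {}"
proof (rule equals0I)
  fix y assume "y \<in> positive_periodic_solutions \<omega> a b \<tau> f lam"
  then obtain x where "x \<in> cone" "T lam x = x" "0 < gauge x"
    using solution_is_fixed_point[OF assms(1)] by metis
  then show False using assms grows_T[of lam x] shrinks_T[of lam x] by auto
qed

text \<open>
  The sets behind \<open>M(r)\<close> and \<open>m(r)\<close> are compact, which turns \<open>GREATEST\<close> and \<open>LEAST\<close> into an
  attained maximum and minimum.
\<close>
lemma f_attains:
  assumes "0 \<le> c" "c \<le> r"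
  defines "V \<equiv> {f i u | i u. u \<in> orthant \<and> c \<le> l1norm u \<and> l1norm u \<le> r}"
  shows "\<exists>y\<in>V. \<forall>z\<in>V. z \<le> y" and "\<exists>y\<in>V. \<forall>z\<in>V. y \<le> z"
proof -
  let ?S = "{u \<in> orthant. c \<le> l1norm u \<and> l1norm u \<le> r} :: (real ^ 'n) set"
  have V: "V = (\<Union>i. f i ` ?S)" by (auto simp: V_def)
  have "compact (f i ` ?S)" for i
    by (intro compact_continuous_image compact_orthant_shell continuous_on_subset[OF cont_f]) auto
  then have "compact V" unfolding V by (intro compact_UN) auto
  moreover have "axis undefined r \<in> ?S" using assms by (simp add: l1norm_axis axis_in_orthant)
  then have "V \<noteq> {}" unfolding V by blast
  ultimately show "\<exists>y\<in>V. \<forall>z\<in>V. z \<le> y" and "\<exists>y\<in>V. \<forall>z\<in>V. y \<le> z"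
    by (auto dest: compact_attains_sup compact_attains_inf)
qed

lemma M_const_upper:
  assumes "0 < r" "u \<in> orthant" "l1norm u \<le> r"
  shows "f i u \<le> M_const f r"
proof -
  let ?V = "{f i u | i u. u \<in> orthant \<and> l1norm u \<le> r}"
  obtain y where y: "y \<in> ?V" "\<And>z. z \<in> ?V \<Longrightarrow> z \<le> y"
    using f_attains(1)[of 0 r] assms(1) by (auto simp: l1norm_nonneg)
  then have "M_const f r = y" unfolding M_const_def by (intro Greatest_equality)
  with y(2)[of "f i u"] assms show ?thesis by auto
qed

lemma m_const_lower:
  assumes "0 < r"
  shows "0 < m_const \<omega> a f r"
    and "\<lbrakk>u \<in> orthant; \<sigma> * r \<le> l1norm u; l1norm u \<le> r\<rbrakk> \<Longrightarrow> m_const \<omega> a f r \<le> f i u"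
proof -
  let ?V = "{f i u | i u. u \<in> orthant \<and> \<sigma> * r \<le> l1norm u \<and> l1norm u \<le> r}"
  have \<sigma>r: "0 < \<sigma> * r" "\<sigma> * r \<le> r" using \<sigma>_pos \<sigma>_lt_1 assms by auto
  obtain y where y: "y \<in> ?V" "\<And>z. z \<in> ?V \<Longrightarrow> y \<le> z"
    using f_attains(2)[of "\<sigma> * r" r] \<sigma>r by (metis (lifting) less_imp_le)
  then have m: "m_const \<omega> a f r = y" unfolding m_const_def by (intro Least_equality)
  show "0 < m_const \<omega> a f r" using y(1) f_pos \<sigma>r unfolding m by auto
  show "m_const \<omega> a f r \<le> f i u" if "u \<in> orthant" "\<sigma> * r \<le> l1norm u" "l1norm u \<le> r"
    using y(2)[of "f i u"] that unfolding m by blast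
qed

lemma M_const_pos: "0 < r \<Longrightarrow> 0 < M_const f r"
proof -
  assume r: "0 < r"
  have u: "axis undefined r \<in> orthant" "l1norm (axis undefined r :: real ^ 'n) = r"
    using r by (simp_all add: l1norm_axis axis_in_orthant)
  then show ?thesis using f_pos[of "axis undefined r"] M_const_upper[OF r u(1)] r by (smt (verit))
qed

lemma grows_m_const: "1 / (m_const \<omega> a f 1 * \<Gamma>) < lam \<Longrightarrow> grows lam 1"
proof -
  assume "1 / (m_const \<omega> a f 1 * \<Gamma>) < lam"
  then have "1 < lam * m_const \<omega> a f 1 * \<Gamma>"
    using m_const_lower(1)[of 1] \<Gamma>_pos by (simp add: pos_divide_less_eq mult_ac)
  then show ?thesis using m_const_lower[of 1] by (auto simp: grows_def intro: less_imp_le)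
qed

lemma shrinks_M_const: "lam < 1 / (M_const f 1 * chi) \<Longrightarrow> shrinks lam 1"
proof -
  assume "lam < 1 / (M_const f 1 * chi)"
  then have "lam * M_const f 1 * chi < 1"
    using M_const_pos[of 1] chi_pos by (simp add: pos_less_divide_eq mult_ac)
  then show ?thesis using M_const_upper[of 1] by (auto simp: shrinks_def)
qed

section \<open>Growth of the nonlinearity near zero and infinity\<close>

text \<open>
  A linear lower bound \<open>C \<parallel>u\<parallel>\<close> is at least \<open>C \<sigma> r\<close> on the shell.
\<close>
lemma growsI:
  assumes "0 < r" "0 \<le> C" "1 < lam * C * \<sigma> * \<Gamma>"
    and "\<And>u. \<lbrakk>u \<in> orthant; \<sigma> * r \<le> l1norm u; l1norm u \<le> r\<rbrakk> \<Longrightarrow> C * l1norm u \<le> f i u"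
  shows "grows lam r"
  unfolding grows_def
proof (intro exI conjI ballI impI)
  show "0 \<le> C * (\<sigma> * r)" using assms \<sigma>_pos by simp
  have "1 * r < lam * C * \<sigma> * \<Gamma> * r" using assms by (intro mult_strict_right_mono)
  then show "r < lam * (C * (\<sigma> * r)) * \<Gamma>" by (simp add: mult_ac)
  fix u :: "real ^ 'n"
  assume u: "u \<in> orthant" "\<sigma> * r \<le> l1norm u" "l1norm u \<le> r"
  then have "C * (\<sigma> * r) \<le> C * l1norm u" using assms by (intro mult_left_mono)
  also have "\<dots> \<le> f i u" using assms(4)[OF u] .
  finally show "C * (\<sigma> * r) \<le> f i u" .
qed

lemma shrinksI:
  assumes "0 < r" "lam * C * chi < 1"
    and "\<And>i u. \<lbrakk>u \<in> orthant; l1norm u \<le> r\<rbrakk> \<Longrightarrow> f i u \<le> C * r"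
  shows "shrinks lam r"
proof -
  have "lam * C * chi * r < 1 * r" using assms by (intro mult_strict_right_mono)
  then have "lam * (C * r) * chi < r" by (simp add: mult_ac)
  then show ?thesis using assms(3) by (auto simp: shrinks_def)
qed

context
  fixes f0 finf :: "'n \<Rightarrow> ennreal"
  assumes lim0: "\<And>i. ((\<lambda>u. ennreal (f i u / l1norm u)) \<longlongrightarrow> f0 i) orthant_at_0"
    and liminf: "\<And>i. ((\<lambda>u. ennreal (f i u / l1norm u)) \<longlongrightarrow> finf i) orthant_at_infinity"
begin

text \<open>
  The limit at \<open>0\<close> concerns only nonzero points. The bound at the origin itself, \<open>f\<^sup>i(0) \<le> 0\<close>,
  follows from continuity along a coordinate axis.
\<close>
lemma f_upper_near_0:
  assumes "f0 i < ennreal C"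
  shows "\<forall>\<^sub>F r in at_right 0. \<forall>u\<in>orthant. l1norm u \<le> r \<longrightarrow> f i u \<le> C * l1norm u"
proof -
  obtain \<rho> where \<rho>: "0 < \<rho>"
    "\<And>u. \<lbrakk>u \<in> orthant; 0 < l1norm u; l1norm u < \<rho>\<rbrakk> \<Longrightarrow> ennreal (f i u / l1norm u) < ennreal C"
    using eventually_orthant_at_0[OF order_tendstoD(2)[OF lim0 assms]] by blast
  have le: "f i u \<le> C * l1norm u" if "u \<in> orthant" "0 < l1norm u" "l1norm u < \<rho>" for u
  proof -
    have "f i u / l1norm u < C"
      using \<rho>(2)[OF that] f_nonneg[OF that(1), of i] that by (simp add: ennreal_less_iff)
    then show ?thesis using that by (simp add: pos_divide_less_eq)
  qed
  let ?e = "\<lambda>t. axis undefined t :: real ^ 'n"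
  have e: "?e t \<in> orthant" "l1norm (?e t) = t" if "0 \<le> t" for t
    using that by (simp_all add: l1norm_axis axis_in_orthant)
  have "f i 0 \<le> 0"
  proof (rule tendsto_le[of "at_right 0"])
    have "((\<lambda>t. ?e t) \<longlongrightarrow> 0) (at_right (0::real))"
    proof (rule vec_tendstoI)
      fix i
      show "((\<lambda>t. ?e t $ i) \<longlongrightarrow> (0 :: real ^ 'n) $ i) (at_right (0::real))"
        by (cases "i = undefined") (simp_all add: axis_def)
    qed
    moreover have "\<forall>\<^sub>F t in at_right (0::real). ?e t \<in> orthant"
      using eventually_at_right_less[of 0] by eventually_elim (use e in auto)
    ultimately show "((\<lambda>t. f i (?e t)) \<longlongrightarrow> f i 0) (at_right 0)"
      by (intro continuous_on_tendsto_compose[OF cont_f]) (auto simp: orthant_def)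
    show "((\<lambda>t. C * t) \<longlongrightarrow> 0) (at_right 0)" by (auto intro!: tendsto_eq_intros)
    have "\<forall>\<^sub>F t in at_right 0. t < \<rho>" using \<rho>(1) eventually_at_right_field by blast
    with eventually_at_right_less[of 0] show "\<forall>\<^sub>F t in at_right 0. f i (?e t) \<le> C * t"
      by eventually_elim (use e le in \<open>metis less_imp_le\<close>)
  qed simp
  then have "f i u \<le> C * l1norm u" if "u \<in> orthant" "l1norm u < \<rho>" for u
    using le[OF that(1) _ that(2)] l1norm_nonneg[of u] by (cases "u = 0") (auto simp: l1norm_eq_0_iff less_le)
  moreover have "\<forall>\<^sub>F r in at_right 0. r < \<rho>" using \<rho>(1) eventually_at_right_field by blast
  ultimately show ?thesis by (auto elim!: eventually_mono)
qed

lemma f_lower_near_0: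
  assumes "ennreal C < f0 i" "0 \<le> C"
  shows "\<forall>\<^sub>F r in at_right 0. \<forall>u\<in>orthant. l1norm u \<le> r \<longrightarrow> C * l1norm u \<le> f i u"
proof -
  obtain \<rho> where \<rho>: "0 < \<rho>"
    "\<And>u. \<lbrakk>u \<in> orthant; 0 < l1norm u; l1norm u < \<rho>\<rbrakk> \<Longrightarrow> ennreal C < ennreal (f i u / l1norm u)"
    using eventually_orthant_at_0[OF order_tendstoD(1)[OF lim0 assms(1)]] by blast
  have le: "C * l1norm u \<le> f i u" if "u \<in> orthant" "l1norm u < \<rho>" for u
  proof (cases "l1norm u = 0")
    case False
    then have u: "0 < l1norm u" using l1norm_nonneg[of u] by linarith
    have "C < f i u / l1norm u" using \<rho>(2)[OF that(1) u that(2)] assms(2) by (simp add: ennreal_less_iff)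
    then show ?thesis using u by (simp add: pos_less_divide_eq)
  qed (use that f_nonneg in simp)
  have "\<forall>\<^sub>F r in at_right 0. r < \<rho>" using \<rho>(1) eventually_at_right_field by blast
  then show ?thesis using le by (auto elim!: eventually_mono)
qed

lemma f_upper_near_infinity:
  assumes "finf i < ennreal C"
  shows "\<forall>\<^sub>F r in at_top. \<forall>u\<in>orthant. r \<le> l1norm u \<longrightarrow> f i u \<le> C * l1norm u"
proof -
  obtain \<rho> where \<rho>:
    "\<And>u. \<lbrakk>u \<in> orthant; \<rho> \<le> l1norm u\<rbrakk> \<Longrightarrow> ennreal (f i u / l1norm u) < ennreal C"
    using eventually_orthant_at_infinity[OF order_tendstoD(2)[OF liminf assms]] by blast
  have le: "f i u \<le> C * l1norm u" if "u \<in> orthant" "\<rho> \<le> l1norm u" "0 < l1norm u" for u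
  proof -
    have "f i u / l1norm u < C"
      using \<rho>[OF that(1,2)] f_nonneg[OF that(1), of i] that by (simp add: ennreal_less_iff)
    then show ?thesis using that by (simp add: pos_divide_less_eq)
  qed
  from eventually_ge_at_top[of \<rho>] eventually_gt_at_top[of 0] show ?thesis
    by eventually_elim (use le in force)
qed

lemma f_lower_near_infinity:
  assumes "ennreal C < finf i" "0 \<le> C"
  shows "\<forall>\<^sub>F r in at_top. \<forall>u\<in>orthant. r \<le> l1norm u \<longrightarrow> C * l1norm u \<le> f i u"
proof -
  obtain \<rho> where \<rho>:
    "\<And>u. \<lbrakk>u \<in> orthant; \<rho> \<le> l1norm u\<rbrakk> \<Longrightarrow> ennreal C < ennreal (f i u / l1norm u)"
    using eventually_orthant_at_infinity[OF order_tendstoD(1)[OF liminf assms(1)]] by blast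
  have le: "C * l1norm u \<le> f i u" if "u \<in> orthant" "\<rho> \<le> l1norm u" "0 < l1norm u" for u
  proof -
    have "C < f i u / l1norm u" using \<rho>[OF that(1,2)] assms(2) by (simp add: ennreal_less_iff)
    then show ?thesis using that by (simp add: pos_less_divide_eq)
  qed
  from eventually_ge_at_top[of \<rho>] eventually_gt_at_top[of 0] show ?thesis
    by eventually_elim (use le in force)
qed

lemma shrinks_near_0:
  assumes "0 < lam" "\<forall>i. f0 i = 0"
  shows "\<forall>\<^sub>F r in at_right 0. shrinks lam r"
proof -
  define C where "C = 1 / (2 * lam * chi)"
  have C: "0 < C" "lam * C * chi < 1" using assms(1) chi_pos by (auto simp: C_def)
  have "\<forall>\<^sub>F r in at_right 0. \<forall>i. \<forall>u\<in>orthant. l1norm u \<le> r \<longrightarrow> f i u \<le> C * l1norm u"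
    using assms(2) C by (intro eventually_all_finite f_upper_near_0) simp
  with eventually_at_right_less[of 0] show ?thesis
  proof eventually_elim
    case (elim r)
    show ?case
    proof (rule shrinksI[OF _ C(2)])
      fix i and u :: "real ^ 'n" assume u: "u \<in> orthant" "l1norm u \<le> r"
      then have "C * l1norm u \<le> C * r" using C by simp
      then show "f i u \<le> C * r" using elim u by (meson order_trans)
    qed (use elim in simp)
  qed
qed

text \<open>
  For points of the ball of radius \<open>r\<close> that are too small for the linear bound, a constant bound
  \<open>M\<close> is available, and it is at most \<open>C r\<close> once \<open>r \<ge> M / C\<close>.
\<close>
lemma shrinks_near_infinity:
  assumes "0 < lam" "\<forall>i. finf i = 0"
  shows "\<forall>\<^sub>F r in at_top. shrinks lam r"
proof -
  define C where "C = 1 / (2 * lam * chi)"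
  have C: "0 < C" "lam * C * chi < 1" using assms(1) chi_pos by (auto simp: C_def)
  have "\<forall>\<^sub>F r in at_top. \<forall>i. \<forall>u\<in>orthant. r \<le> l1norm u \<longrightarrow> f i u \<le> C * l1norm u"
    using assms(2) C by (intro eventually_all_finite f_upper_near_infinity) simp
  then obtain \<rho> where \<rho>: "\<forall>i. \<forall>u\<in>orthant. \<rho> \<le> l1norm u \<longrightarrow> f i u \<le> C * l1norm u"
    by (auto simp: eventually_at_top_linorder)
  obtain M where M: "\<forall>i. \<forall>u\<in>orthant. l1norm u \<le> \<rho> \<longrightarrow> f i u \<le> M" using f_bounded[of \<rho>] ..
  from eventually_gt_at_top[of 0] eventually_ge_at_top[of "M / C"] show ?thesis
  proof eventually_elim
    case (elim r)
    show ?case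
    proof (rule shrinksI[OF _ C(2)])
      fix i and u :: "real ^ 'n" assume u: "u \<in> orthant" "l1norm u \<le> r"
      show "f i u \<le> C * r"
      proof (cases "\<rho> \<le> l1norm u")
        case True
        have "C * l1norm u \<le> C * r" using C u by simp
        then show ?thesis using \<rho> u True by (meson order_trans)
      next
        case False
        then have "f i u \<le> M" using M u by simp
        also have "M \<le> C * r" using elim C by (simp add: pos_divide_le_eq mult.commute)
        finally show ?thesis .
      qed
    qed (use elim in simp)
  qed
qed

lemma grows_near_0:
  assumes "0 < lam" "f0 i = \<infinity>"
  shows "\<forall>\<^sub>F r in at_right 0. grows lam r"
proof -
  define C where "C = 2 / (lam * \<sigma> * \<Gamma>)"
  have C: "0 \<le> C" "1 < lam * C * \<sigma> * \<Gamma>" using assms(1) \<sigma>_pos \<Gamma>_pos by (auto simp: C_def)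
  have "\<forall>\<^sub>F r in at_right 0. \<forall>u\<in>orthant. l1norm u \<le> r \<longrightarrow> C * l1norm u \<le> f i u"
    using assms(2) C by (intro f_lower_near_0) auto
  with eventually_at_right_less[of 0] show ?thesis
    by eventually_elim (rule growsI[OF _ C], auto)
qed

lemma grows_near_infinity:
  assumes "0 < lam" "finf i = \<infinity>"
  shows "\<forall>\<^sub>F r in at_top. grows lam r"
proof -
  define C where "C = 2 / (lam * \<sigma> * \<Gamma>)"
  have C: "0 \<le> C" "1 < lam * C * \<sigma> * \<Gamma>" using assms(1) \<sigma>_pos \<Gamma>_pos by (auto simp: C_def)
  have "\<forall>\<^sub>F r in at_top. \<forall>u\<in>orthant. r \<le> l1norm u \<longrightarrow> C * l1norm u \<le> f i u"
    using assms(2) C by (intro f_lower_near_infinity) auto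
  then obtain \<rho> where \<rho>: "\<forall>u\<in>orthant. \<rho> \<le> l1norm u \<longrightarrow> C * l1norm u \<le> f i u"
    by (auto simp: eventually_at_top_linorder)
  from eventually_gt_at_top[of 0] eventually_ge_at_top[of "\<rho> / \<sigma>"] show ?thesis
  proof eventually_elim
    case (elim r)
    then have "\<rho> \<le> \<sigma> * r" using \<sigma>_pos by (simp add: pos_divide_le_eq mult.commute)
    then show ?case using \<rho> elim by (intro growsI[OF _ C, of _ i]) auto
  qed
qed

text \<open>
  The two positive limits may belong to different components \<open>i\<close> and \<open>j\<close>, but a shell
  \<open>\<sigma> r \<le> \<parallel>u\<parallel> \<le> r\<close> needs one component that is bounded below on all of it. Let \<open>f\<^sup>j\<close> have a linear
  lower bound outside radius \<open>\<rho>\<close>. Component \<open>j\<close> serves the shells outside \<open>\<rho>\<close>; all other shells lie in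
  the ball of radius \<open>\<rho> / \<sigma>\<close>, where \<open>f\<^sup>i\<close> has a linear lower bound by its behaviour at \<open>0\<close> and by
  compactness.
\<close>
lemma grows_everywhere:
  assumes "0 < f0 i" "0 < finf j"
  shows "\<forall>\<^sub>F lam in at_top. \<forall>r>0. grows lam r"
proof -
  obtain C0 where C0: "0 < C0" "ennreal C0 < f0 i"
    using ennreal_between[OF assms(1)] by metis
  obtain C1 where C1: "0 < C1" "ennreal C1 < finf j"
    using ennreal_between[OF assms(2)] by metis
  obtain r0 where r0: "0 < r0" "\<forall>u\<in>orthant. l1norm u \<le> r0 \<longrightarrow> C0 * l1norm u \<le> f i u"
    using eventually_happens'[OF _ eventually_conj[OF eventually_at_right_less f_lower_near_0[OF C0(2)]]] C0(1)
    by auto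
  obtain \<rho> where \<rho>: "0 < \<rho>" "\<forall>u\<in>orthant. \<rho> \<le> l1norm u \<longrightarrow> C1 * l1norm u \<le> f j u"
    using eventually_happens'[OF _ eventually_conj[OF eventually_gt_at_top[of 0] f_lower_near_infinity[OF C1(2)]]] C1(1)
    by auto
  obtain m where m: "0 < m" "\<forall>u\<in>orthant. r0 \<le> l1norm u \<longrightarrow> l1norm u \<le> \<rho> / \<sigma> \<longrightarrow> m \<le> f i u"
    using f_lower_shell[OF r0(1), of "\<rho> / \<sigma>" i] by auto
  \<comment> \<open>For \<open>r0 \<le> \<parallel>u\<parallel> \<le> \<rho> / \<sigma>\<close> the third term makes \<open>C \<parallel>u\<parallel>\<close> at most \<open>m\<close>.\<close>
  define C where "C = min (min C0 C1) (m * \<sigma> / \<rho>)"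
  have C: "0 < C" "C \<le> C0" "C \<le> C1" "C \<le> m * \<sigma> / \<rho>"
    using C0 C1 m \<rho> \<sigma>_pos by (auto simp: C_def)
  have i: "C * l1norm u \<le> f i u" if u: "u \<in> orthant" "l1norm u \<le> \<rho> / \<sigma>" for u
  proof (cases "l1norm u \<le> r0")
    case True
    have "C * l1norm u \<le> C0 * l1norm u" using C l1norm_nonneg by (intro mult_right_mono)
    then show ?thesis using r0(2) u(1) True by (meson order_trans)
  next
    case False
    have "C * l1norm u \<le> (m * \<sigma> / \<rho>) * (\<rho> / \<sigma>)"
      using C u(2) l1norm_nonneg[of u] by (intro mult_mono) auto
    also have "\<dots> = m" using \<rho> \<sigma>_pos by simp
    finally show ?thesis using m(2) u False by (meson linear order_trans)
  qed
  have j: "C * l1norm u \<le> f j u" if u: "u \<in> orthant" "\<rho> \<le> l1norm u" for u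
  proof -
    have "C * l1norm u \<le> C1 * l1norm u" using C l1norm_nonneg by (intro mult_right_mono)
    then show ?thesis using \<rho>(2) u by (meson order_trans)
  qed
  from eventually_gt_at_top[of "1 / (C * \<sigma> * \<Gamma>)"] show ?thesis
  proof eventually_elim
    case (elim lam)
    then have lam: "1 < lam * C * \<sigma> * \<Gamma>"
      using C \<sigma>_pos \<Gamma>_pos by (simp add: pos_divide_less_eq mult_ac)
    show ?case
    proof (intro allI impI)
      fix r :: real assume r: "0 < r"
      show "grows lam r"
      proof (cases "r \<le> \<rho> / \<sigma>")
        case True
        show ?thesis by (rule growsI[OF r _ lam, of i]) (use C i True in auto)
      next
        case False
        then have "\<rho> / \<sigma> < r" by simp
        then have "\<rho> < r * \<sigma>" using \<sigma>_pos by (simp only: pos_divide_less_eq)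
        then have "\<rho> \<le> \<sigma> * r" by (simp add: mult.commute)
        show ?thesis by (rule growsI[OF r _ lam, of j]) (use C j \<open>\<rho> \<le> \<sigma> * r\<close> in auto)
      qed
    qed
  qed
qed

text \<open>
  Finite limits at both ends and compactness in between give one linear upper bound for all
  components on the whole orthant.
\<close>
lemma shrinks_everywhere:
  assumes "\<forall>i. f0 i \<noteq> \<infinity>" "\<forall>i. finf i \<noteq> \<infinity>"
  shows "\<forall>\<^sub>F lam in at_right 0. \<forall>r>0. shrinks lam r"
proof -
  have bounded: "\<exists>C. \<forall>i. g i < ennreal C" if "\<forall>i. g i \<noteq> \<infinity>" for g :: "'n \<Rightarrow> ennreal"
  proof -
    have "Max (range g) < \<infinity>" using Max_in[of "range g"] that by (auto simp: less_top)
    then obtain C where "Max (range g) < ennreal C" using ennreal_between by metis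
    then have "g i < ennreal C" for i using Max_ge[of "range g" "g i"] by (auto intro: le_less_trans)
    then show ?thesis by blast
  qed
  obtain C0 where C0: "\<forall>i. f0 i < ennreal C0" using bounded[OF assms(1)] ..
  obtain C1 where C1: "\<forall>i. finf i < ennreal C1" using bounded[OF assms(2)] ..
  have ev0: "\<forall>\<^sub>F r in at_right 0. \<forall>i. \<forall>u\<in>orthant. l1norm u \<le> r \<longrightarrow> f i u \<le> C0 * l1norm u"
    using C0 by (intro eventually_all_finite f_upper_near_0) simp
  obtain r0 where r0: "0 < r0" "\<forall>i. \<forall>u\<in>orthant. l1norm u \<le> r0 \<longrightarrow> f i u \<le> C0 * l1norm u"
    using eventually_happens'[OF _ eventually_conj[OF eventually_at_right_less ev0]] by auto
  have "\<forall>\<^sub>F r in at_top. \<forall>i. \<forall>u\<in>orthant. r \<le> l1norm u \<longrightarrow> f i u \<le> C1 * l1norm u"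
    using C1 by (intro eventually_all_finite f_upper_near_infinity) simp
  then obtain \<rho> where \<rho>: "\<forall>i. \<forall>u\<in>orthant. \<rho> \<le> l1norm u \<longrightarrow> f i u \<le> C1 * l1norm u"
    by (auto simp: eventually_at_top_linorder)
  obtain M where M: "\<forall>i. \<forall>u\<in>orthant. l1norm u \<le> \<rho> \<longrightarrow> f i u \<le> M" using f_bounded[of \<rho>] ..
  define C where "C = Max {1, C0, C1, M / r0}"
  have C: "0 < C" "C0 \<le> C" "C1 \<le> C" "M / r0 \<le> C"
    by (auto simp: C_def less_max_iff_disj intro: Max_ge)
  have le: "f i u \<le> C * l1norm u" if u: "u \<in> orthant" for i u
  proof -
    consider "l1norm u \<le> r0" | "\<rho> \<le> l1norm u" | "r0 < l1norm u" "l1norm u < \<rho>" by linarith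
    then show ?thesis
    proof cases
      case 1
      have "C0 * l1norm u \<le> C * l1norm u" using C l1norm_nonneg by (intro mult_right_mono)
      then show ?thesis using r0(2) u 1 by (meson order_trans)
    next
      case 2
      have "C1 * l1norm u \<le> C * l1norm u" using C l1norm_nonneg by (intro mult_right_mono)
      then show ?thesis using \<rho> u 2 by (meson order_trans)
    next
      case 3
      have "f i u \<le> M" using M u 3 by simp
      also have "M \<le> C * r0" using C r0 by (simp add: pos_divide_le_eq)
      also have "\<dots> \<le> C * l1norm u" using C 3 by simp
      finally show ?thesis .
    qed
  qed
  have "\<forall>\<^sub>F lam in at_right 0. lam < 1 / (C * chi)"
    using C chi_pos by (intro eventually_at_right_field[THEN iffD2] exI[of _ "1 / (C * chi)"]) auto
  then show ?thesis
  proof eventually_elim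
    case (elim lam)
    then have lam: "lam * C * chi < 1"
      using C chi_pos by (simp add: pos_less_divide_eq mult_ac)
    show ?case
    proof (intro allI impI)
      fix r :: real assume r: "0 < r"
      show "shrinks lam r"
      proof (rule shrinksI[OF r lam])
        fix i and u :: "real ^ 'n" assume u: "u \<in> orthant" "l1norm u \<le> r"
        then have "C * l1norm u \<le> C * r" using C by simp
        then show "f i u \<le> C * r" using le[OF u(1)] order_trans by blast
      qed
    qed
  qed
qed

end

section \<open>Counting the positive periodic solutions\<close>
lemma solution_below:
  assumes "0 < lam" "0 < R"
    and "grows lam R \<and> (\<forall>\<^sub>F r in at_right 0. shrinks lam r) \<or>
         shrinks lam R \<and> (\<forall>\<^sub>F r in at_right 0. grows lam r)"
  shows "\<exists>y\<in>positive_periodic_solutions \<omega> a b \<tau> f lam. gauge y < R"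
proof -
  have ev: "\<forall>\<^sub>F r in at_right 0. 0 < r \<and> r < R"
    using assms(2) eventually_at_right_field[of "\<lambda>r. 0 < r \<and> r < R" 0] by auto
  have "\<exists>r. (0 < r \<and> r < R) \<and> (grows lam r \<and> shrinks lam R \<or> shrinks lam r \<and> grows lam R)"
    using assms(3)
  proof (elim disjE conjE)
    assume "grows lam R" "\<forall>\<^sub>F r in at_right 0. shrinks lam r"
    then show ?thesis using eventually_happens'[OF _ eventually_conj[OF ev]] by fastforce
  next
    assume "shrinks lam R" "\<forall>\<^sub>F r in at_right 0. grows lam r"
    then show ?thesis using eventually_happens'[OF _ eventually_conj[OF ev]] by fastforce
  qed
  then show ?thesis using solution_between[OF assms(1)] by blast
qed

lemma solution_above:
  assumes "0 < lam" "0 < r"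
    and "grows lam r \<and> (\<forall>\<^sub>F R in at_top. shrinks lam R) \<or>
         shrinks lam r \<and> (\<forall>\<^sub>F R in at_top. grows lam R)"
  shows "\<exists>y\<in>positive_periodic_solutions \<omega> a b \<tau> f lam. r < gauge y"
proof -
  have "\<exists>R. r < R \<and> (grows lam r \<and> shrinks lam R \<or> shrinks lam r \<and> grows lam R)"
    using assms(3)
  proof (elim disjE conjE)
    assume "grows lam r" "\<forall>\<^sub>F R in at_top. shrinks lam R"
    then show ?thesis
      using eventually_happens'[OF _ eventually_conj[OF eventually_gt_at_top[of r]]] by fastforce
  next
    assume "shrinks lam r" "\<forall>\<^sub>F R in at_top. grows lam R"
    then show ?thesis
      using eventually_happens'[OF _ eventually_conj[OF eventually_gt_at_top[of r]]] by fastforce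
  qed
  then show ?thesis using solution_between[OF assms(1,2)] by blast
qed

end

text \<open>
  The threshold \<open>c\<close> separates the two solutions found on either side of it.
\<close>
lemma has_at_least_around:
  fixes G :: "'a \<Rightarrow> real"
  assumes "A \<Longrightarrow> \<exists>x\<in>S. G x < c" "B \<Longrightarrow> \<exists>x\<in>S. c < G x"
  shows "has_at_least (of_bool A + of_bool B) S"
proof -
  have single: "\<exists>X\<subseteq>{x \<in> S. P x}. finite X \<and> card X = of_bool Q" if "Q \<Longrightarrow> \<exists>x\<in>S. P x" for P Q
  proof (cases Q)
    case True
    with that obtain x where "x \<in> S" "P x" by blast
    with True show ?thesis by (intro exI[of _ "{x}"]) simp
  qed (intro exI[of _ "{}"], simp)
  obtain X where X: "X \<subseteq> {x \<in> S. G x < c}" "finite X" "card X = of_bool A"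
    using single[of A "\<lambda>x. G x < c"] assms(1) by auto
  obtain Y where Y: "Y \<subseteq> {x \<in> S. c < G x}" "finite Y" "card Y = of_bool B"
    using single[of B "\<lambda>x. c < G x"] assms(2) by auto
  have "X \<inter> Y = {}" using X(1) Y(1) by fastforce
  then have "card (X \<union> Y) = of_bool A + of_bool B" using X Y by (simp add: card_Un_disjoint)
  moreover have "X \<union> Y \<subseteq> S" "finite (X \<union> Y)" using X Y by auto
  ultimately show ?thesis unfolding has_at_least_def by blast
qed

lemma num_zeros_eq:
  "num_zeros f0 finf = of_bool (\<forall>i. f0 i = 0) + of_bool (\<forall>i. finf i = 0)"
proof -
  have "Max (range g) = 0 \<longleftrightarrow> (\<forall>i. g i = 0)" for g :: "'a::finite \<Rightarrow> ennreal"
  proof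
    assume "Max (range g) = 0"
    then have "g i \<le> 0" for i using Max_ge[of "range g" "g i"] by simp
    then show "\<forall>i. g i = 0" by simp
  next
    assume "\<forall>i. g i = 0"
    then have "range g = {0}" by auto
    then show "Max (range g) = 0" by simp
  qed
  then show ?thesis by (simp add: num_zeros_def)
qed

lemma num_infinities_eq:
  "num_infinities f0 finf = of_bool (\<exists>i. f0 i = \<infinity>) + of_bool (\<exists>i. finf i = \<infinity>)"
proof -
  have "Max (range g) = \<infinity> \<longleftrightarrow> (\<exists>i. g i = \<infinity>)" for g :: "'a::finite \<Rightarrow> ennreal"
  proof
    assume "Max (range g) = \<infinity>"
    then have "\<infinity> \<in> range g" using Max_in[of "range g"] by simp
    then show "\<exists>i. g i = \<infinity>" by (metis imageE)
  next
    assume "\<exists>i. g i = \<infinity>"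
    then obtain i where i: "g i = \<infinity>" ..
    have "g i \<le> Max (range g)" by simp
    then show "Max (range g) = \<infinity>" using i by (simp add: top_unique)
  qed
  then show ?thesis by (simp add: num_infinities_def)
qed

theorem theorem2p1:
  fixes \<omega> :: real
    and a b :: "'n::finite \<Rightarrow> real \<Rightarrow> real"
    and \<tau> :: "real \<Rightarrow> real"
    and f :: "'n \<Rightarrow> real ^ 'n \<Rightarrow> real"
    and f0 finf :: "'n \<Rightarrow> ennreal"
  assumes "\<omega> > 0"
    and "\<And>i. continuous_on UNIV (a i)" and "\<And>i t. a i t \<ge> 0"
    and "\<And>i. periodic \<omega> (a i)" and "\<And>i. mean \<omega> (a i) > 0"
    and "\<And>i. continuous_on UNIV (b i)" and "\<And>i t. b i t \<ge> 0"
    and "\<And>i. periodic \<omega> (b i)" and "\<And>i. mean \<omega> (b i) > 0"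
    and "continuous_on UNIV \<tau>" and "periodic \<omega> \<tau>"
    and "\<And>i. continuous_on orthant (f i)"
    and "\<And>i x. x \<in> orthant \<Longrightarrow> f i x \<ge> 0"
    and "\<And>i x. x \<in> orthant \<Longrightarrow> l1norm x > 0 \<Longrightarrow> f i x > 0"
    and "\<And>i. ((\<lambda>x. ennreal (f i x / l1norm x)) \<longlongrightarrow> f0 i) orthant_at_0"
    and "\<And>i. ((\<lambda>x. ennreal (f i x / l1norm x)) \<longlongrightarrow> finf i) orthant_at_infinity"
  shows
    "(num_zeros f0 finf \<in> {1, 2} \<longrightarrow>
        1 / (m_const \<omega> a f 1 * Gamma_const \<omega> a b) > 0 \<and>
        (\<forall>lam. lam > 1 / (m_const \<omega> a f 1 * Gamma_const \<omega> a b) \<longrightarrow>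
           has_at_least (num_zeros f0 finf) (positive_periodic_solutions \<omega> a b \<tau> f lam))) \<and>
     (num_infinities f0 finf \<in> {1, 2} \<longrightarrow>
        (\<forall>lam. 0 < lam \<and> lam < 1 / (M_const f 1 * chi_const \<omega> a b) \<longrightarrow>
           has_at_least (num_infinities f0 finf) (positive_periodic_solutions \<omega> a b \<tau> f lam))) \<and>
     (num_zeros f0 finf = 0 \<longrightarrow>
        (\<forall>\<^sub>F lam in at_top. positive_periodic_solutions \<omega> a b \<tau> f lam = {})) \<and>
     (num_infinities f0 finf = 0 \<longrightarrow>
        (\<forall>\<^sub>F lam in at_right 0. positive_periodic_solutions \<omega> a b \<tau> f lam = {})) \<and>
     (num_zeros f0 finf = 1 \<and> num_infinities f0 finf = 1 \<longrightarrow>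
        (\<forall>lam>0. positive_periodic_solutions \<omega> a b \<tau> f lam \<noteq> {}))"
proof -
  interpret delay_system \<omega> a b \<tau> f
    by unfold_locales (fact assms | (rule assms; assumption))+
  note lims = assms(15,16)
  let ?S = "positive_periodic_solutions \<omega> a b \<tau> f"
  have pos: "0 < 1 / (m_const \<omega> a f 1 * \<Gamma>)"
    using m_const_lower(1)[of 1] \<Gamma>_pos by simp
  have part_a: "has_at_least (num_zeros f0 finf) (?S lam)" if "1 / (m_const \<omega> a f 1 * \<Gamma>) < lam" for lam
  proof -
    have lam: "0 < lam" using pos that by linarith
    note g = grows_m_const[OF that]
    show ?thesis
      unfolding num_zeros_eq
    proof (rule has_at_least_around[where G = gauge and c = 1])
      assume "\<forall>i. f0 i = 0"
      then show "\<exists>x\<in>?S lam. gauge x < 1"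
        using solution_below[OF lam zero_less_one] shrinks_near_0[OF lims lam] g by blast
    next
      assume "\<forall>i. finf i = 0"
      then show "\<exists>x\<in>?S lam. 1 < gauge x"
        using solution_above[OF lam zero_less_one] shrinks_near_infinity[OF lims lam] g by blast
    qed
  qed
  have part_b: "has_at_least (num_infinities f0 finf) (?S lam)"
    if lam: "0 < lam" and "lam < 1 / (M_const f 1 * chi)" for lam
  proof -
    note s = shrinks_M_const[OF that(2)]
    show ?thesis
      unfolding num_infinities_eq
    proof (rule has_at_least_around[where G = gauge and c = 1])
      assume "\<exists>i. f0 i = \<infinity>"
      then show "\<exists>x\<in>?S lam. gauge x < 1"
        using solution_below[OF lam zero_less_one] grows_near_0[OF lims lam] s by blast
    next
      assume "\<exists>i. finf i = \<infinity>"
      then show "\<exists>x\<in>?S lam. 1 < gauge x"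
        using solution_above[OF lam zero_less_one] grows_near_infinity[OF lims lam] s by blast
    qed
  qed
  have part_c1: "\<forall>\<^sub>F lam in at_top. ?S lam = {}" if zeros: "num_zeros f0 finf = 0"
  proof -
    obtain i j where "f0 i \<noteq> 0" "finf j \<noteq> 0" using zeros by (auto simp: num_zeros_eq split: if_splits)
    then have "0 < f0 i" "0 < finf j" by (simp_all add: zero_less_iff_neq_zero)
    from grows_everywhere[OF lims this] eventually_gt_at_top[of 0] show ?thesis
      by eventually_elim (use no_solution in blast)
  qed
  have part_c2: "\<forall>\<^sub>F lam in at_right 0. ?S lam = {}" if infs: "num_infinities f0 finf = 0"
  proof -
    have "\<forall>i. f0 i \<noteq> \<infinity>" "\<forall>i. finf i \<noteq> \<infinity>"
      using infs by (auto simp: num_infinities_eq split: if_splits)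
    from shrinks_everywhere[OF lims this] eventually_at_right_less[of 0] show ?thesis
      by eventually_elim (use no_solution in blast)
  qed
  have part_d: "?S lam \<noteq> {}"
    if zi: "num_zeros f0 finf = 1" "num_infinities f0 finf = 1" and lam: "0 < lam" for lam
  proof -
    \<comment> \<open>One zero and one infinity among two limits must sit at different ends.\<close>
    have exchange: "Z0 \<and> Iinf \<or> Zinf \<and> I0"
      if "Z0 \<noteq> Zinf" "I0 \<noteq> Iinf" "\<not> (Z0 \<and> I0)" "\<not> (Zinf \<and> Iinf)" for Z0 Zinf I0 Iinf
      using that by blast
    have one: "of_bool P + of_bool Q = (1 :: nat) \<longleftrightarrow> P \<noteq> Q" for P Q
      by (cases P; cases Q) simp_all
    have "(\<forall>i. f0 i = 0) \<and> (\<exists>i. finf i = \<infinity>) \<or> (\<forall>i. finf i = 0) \<and> (\<exists>i. f0 i = \<infinity>)"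
      by (rule exchange[OF zi(1)[unfolded num_zeros_eq one] zi(2)[unfolded num_infinities_eq one]]) auto
    then show ?thesis
    proof (elim disjE conjE exE)
      fix i assume *: "\<forall>i. f0 i = 0" "finf i = \<infinity>"
      obtain R where R: "0 < R" "grows lam R"
        using eventually_happens'[OF _ eventually_conj[OF eventually_gt_at_top[of 0] grows_near_infinity[OF lims lam *(2)]]]
        by auto
      show ?thesis
        using solution_below[OF lam R(1)] R(2) shrinks_near_0[OF lims lam *(1)] by blast
    next
      fix i assume *: "\<forall>i. finf i = 0" "f0 i = \<infinity>"
      obtain R where R: "0 < R" "shrinks lam R"
        using eventually_happens'[OF _ eventually_conj[OF eventually_gt_at_top[of 0] shrinks_near_infinity[OF lims lam *(1)]]]
        by auto
      show ?thesis
        using solution_below[OF lam R(1)] R(2) grows_near_0[OF lims lam *(2)] by blast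
    qed
  qed
  show ?thesis
    by (intro conjI impI allI; (elim conjE)?; (rule pos part_a part_b part_c1 part_c2 part_d; assumption))
qed

end
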